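(* Let $d\ge 1$ be an integer, let $\varphi:\mathbb{R}^2\to\mathbb{R}$ be final-time data, and let $u^\varepsilon(t,m,\xi,\eta)$ be the scaled value function defined by the dynamic programming principle (see context) with $u^\varepsilon(T,m,\xi,\eta)=\varphi(\xi,\eta)$. Let $C_d^\#$ be the optimal value of the investor's linear program, and let $u(t,\xi,\eta)$ be a solution of $$u_t+\tfrac12 C_d^\#\Big\langle D^2u\,\frac{\nabla^\perp u}{u_\eta},\frac{\nabla^\perp u}{u_\eta}\Big\rangle=0\ \ (t<T),\qquad u(T,\xi,\eta)=\varphi(\xi,\eta).$$ Assume that $u$ satisfies: (i) $u$ has continuous, uniformly bounded derivatives in $(\xi,\eta)$ of order up to $4$; $u_t$ has continuous, uniformly bounded derivatives in $(\xi,\eta)$ of order up to $2$; and $u_{tt}$ is continuous and uniformly bounded, all bounds being uniform as $t\uparrow T$; (ii) $u_\eta>c>0$ for some constant $c$ uniform in space and time; (iii) $|u_\xi|\le u_\eta$; (iv) $u_t\le 0$. Then there is a constant $C$ (independent of $\varepsilon$, $t$, and $T$) such that $$u^\varepsilon(t,m,\xi,\eta)\le u(t,\xi,\eta)+C\,[(T-t)+\varepsilon]\,\varepsilon\qquad\text{for } t<T,\ \xi\in\mathbb{R},\ \eta\in\mathbb{R},\ m\in\{0,1\}^d,$$ whenever $\varepsilon>0$ is small enough and $t$ is such that $N=(T-t)/\varepsilon^2$ is an integer.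
   Context: States and experts. The states are $m=(a_1,\dots,a_d)\in\{0,1\}^d$ (with $a_d$ the most recent entry), identified with the integers $0,\dots,2^d-1$ by reading $a_1\cdots a_d$ in binary. For a state $m$ put $m_+=(a_2,\dots,a_d,1)$ and $m_-=(a_2,\dots,a_d,0)$; for $b=\pm1$ write $m_b=m_+$ if $b=1$ and $m_b=m_-$ if $b=-1$. Two experts are given by functions $q,r:\{0,1\}^d\to\mathbb{R}$ with $|q(m)|<1$ and $|r(m)|<1$ for all $m$, and $q(m)\ne r(m)$ for at least one $m$. Value function. For $\varepsilon>0$, $u^\varepsilon(t,m,\xi,\eta)$ is defined for times $t\le T$ with $(T-t)/\varepsilon^2$ a nonnegative integer, $m\in\{0,1\}^d$, $(\xi,\eta)\in\mathbb{R}^2$, by $u^\varepsilon(T,m,\xi,\eta)=\varphi(\xi,\eta)$ and, working backward in time, $$u^\varepsilon(t,m,\xi,\eta)=\min_{|f|\le1}\max_{b=\pm1}u^\varepsilon\big(t+\varepsilon^2,\,m_b,\,\xi+\varepsilon b[q(m)-r(m)],\,\eta+\varepsilon b[q(m)+r(m)-2f]\big).$$ Notation. $\nabla^\perp u=(-u_\eta,u_\xi)$ and $D^2u$ is the Hessian of $u$ in $(\xi,\eta)$. Graph and linear program. Consider the directed graph (the $d$-dimensional de Bruijn graph on 2 symbols) with vertex set $\{0,1\}^d$ and edges from $m$ to $m_+$ and from $m$ to $m_-$ for each $m$. A simple cycle is a closed walk with at least one edge and no repeated vertices apart from the first and last, which are equal (loops count as simple cycles of length one; cycles differing only in the starting vertex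 are identified). For a simple cycle $s$ let $|s|$ be its number of edges, and for a vertex $m$ on $s$ let $b_{s,m}=+1$ if $s$ leaves $m$ by the edge to $m_+$ and $b_{s,m}=-1$ if it leaves $m$ by the edge to $m_-$. The investor's linear program is: over $(\beta_0,\dots,\beta_{2^d-1},M)\in\mathbb{R}^{2^d+1}$, minimize $M$ subject to $$\sum_{m\text{ on }s}\big[(q(m)-r(m))^2-b_{s,m}\beta_m\big]\le |s|\,M\quad\text{for every simple cycle } s.$$ *)

theory Defs
  imports "HOL-Analysis.Analysis" "Graph_Theory.Arc_Walk"
begin

section \<open>States and the de Bruijn graph\<close>

text \<open>A state \<open>(a\<^sub>1, \<dots>, a\<^sub>d)\<close> is the list \<open>[a\<^sub>1, \<dots>, a\<^sub>d]\<close>, so the most recent entry is last.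
  An outcome \<open>b = \<plusminus>1\<close> is a boolean, \<^const>\<open>True\<close> standing for \<open>+1\<close>.\<close>

definition states :: "nat \<Rightarrow> bool list set" where
  "states d = {m. length m = d}"

definition outcome :: "bool \<Rightarrow> real" where
  "outcome b = (if b then 1 else -1)"

definition next_state :: "bool list \<Rightarrow> bool \<Rightarrow> bool list" where
  "next_state m b = tl m @ [b]"

text \<open>The arc \<open>(m, b)\<close> runs from \<open>m\<close> to \<open>m\<^sub>b\<close>. For \<open>d \<ge> 1\<close> the two successors of \<open>m\<close> differ, so the
  labels do not create parallel arcs (\<open>nomulti_digraph_de_bruijn\<close> below).\<close>

definition de_bruijn :: "nat \<Rightarrow> (bool list, bool list \<times> bool) pre_digraph" where
  "de_bruijn d = \<lparr>verts = states d, arcs = states d \<times> UNIV,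
                  tail = fst, head = (\<lambda>(m, b). next_state m b)\<rparr>"

lemma nomulti_digraph_de_bruijn:
  assumes "d \<ge> 1"
  shows "nomulti_digraph (de_bruijn d)"
proof unfold_locales
  fix e1 e2 assume "e1 \<in> arcs (de_bruijn d)" "e2 \<in> arcs (de_bruijn d)"
    and "arc_to_ends (de_bruijn d) e1 = arc_to_ends (de_bruijn d) e2"
  then show "e1 = e2"
    by (cases e1; cases e2) (simp add: de_bruijn_def next_state_def arc_to_ends_def)
qed (use assms in \<open>auto simp: de_bruijn_def states_def next_state_def\<close>)

section \<open>The investor's linear program\<close>

text \<open>A cycle \<open>s\<close> is a list of arcs; it has no repeated vertex, so it contains exactly one arc
  \<open>(m, b)\<close> for each vertex \<open>m\<close> on it, and \<open>b\<close> is then \<open>b\<^bsub>s,m\<^esub>\<close>.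
  Only the values of \<open>\<beta>\<close> on \<^term>\<open>states d\<close> matter.\<close>

definition lp_feasible ::
  "nat \<Rightarrow> (bool list \<Rightarrow> real) \<Rightarrow> (bool list \<Rightarrow> real) \<Rightarrow> (bool list \<Rightarrow> real) \<Rightarrow> real \<Rightarrow> bool" where
  "lp_feasible d q r \<beta> M \<longleftrightarrow>
     (\<forall>s. pre_digraph.cycle (de_bruijn d) s \<longrightarrow>
        (\<Sum>(m, b)\<leftarrow>s. (q m - r m)\<^sup>2 - outcome b * \<beta> m) \<le> real (length s) * M)"

definition lp_value :: "nat \<Rightarrow> (bool list \<Rightarrow> real) \<Rightarrow> (bool list \<Rightarrow> real) \<Rightarrow> real" where
  "lp_value d q r = Inf {M. \<exists>\<beta>. lp_feasible d q r \<beta> M}"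

section \<open>The value function\<close>

text \<open>The value when \<open>n\<close> steps remain. The minimum over \<open>\<bar>f\<bar> \<le> 1\<close> is written as an infimum; the two
  agree for continuous \<open>\<phi>\<close>.\<close>

primrec value_steps ::
  "(bool list \<Rightarrow> real) \<Rightarrow> (bool list \<Rightarrow> real) \<Rightarrow> (real \<Rightarrow> real \<Rightarrow> real) \<Rightarrow> real
    \<Rightarrow> nat \<Rightarrow> bool list \<Rightarrow> real \<Rightarrow> real \<Rightarrow> real" where
  "value_steps q r \<phi> \<epsilon> 0 = (\<lambda>m \<xi> \<eta>. \<phi> \<xi> \<eta>)"
| "value_steps q r \<phi> \<epsilon> (Suc n) = (\<lambda>m \<xi> \<eta>.
     INF f\<in>{-1..1}. MAX b.
       value_steps q r \<phi> \<epsilon> n (next_state m b)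
         (\<xi> + \<epsilon> * outcome b * (q m - r m))
         (\<eta> + \<epsilon> * outcome b * (q m + r m - 2 * f)))"

definition value_fun ::
  "(bool list \<Rightarrow> real) \<Rightarrow> (bool list \<Rightarrow> real) \<Rightarrow> (real \<Rightarrow> real \<Rightarrow> real) \<Rightarrow> real \<Rightarrow> real
    \<Rightarrow> real \<Rightarrow> bool list \<Rightarrow> real \<Rightarrow> real \<Rightarrow> real" where
  "value_fun q r \<phi> T \<epsilon> t = value_steps q r \<phi> \<epsilon> (nat \<lfloor>(T - t) / \<epsilon>\<^sup>2\<rfloor>)"

lemma value_fun_final: "value_fun q r \<phi> T \<epsilon> T m \<xi> \<eta> = \<phi> \<xi> \<eta>"
  by (simp add: value_fun_def)

lemma value_fun_dpp:
  assumes "\<epsilon> > 0" "t < T" "(T - t) / \<epsilon>\<^sup>2 \<in> \<int>"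
  shows "value_fun q r \<phi> T \<epsilon> t m \<xi> \<eta> =
    (INF f\<in>{-1..1}. MAX b.
       value_fun q r \<phi> T \<epsilon> (t + \<epsilon>\<^sup>2) (next_state m b)
         (\<xi> + \<epsilon> * outcome b * (q m - r m))
         (\<eta> + \<epsilon> * outcome b * (q m + r m - 2 * f)))"
proof -
  obtain k where k: "(T - t) / \<epsilon>\<^sup>2 = of_int k"
    using assms(3) by (auto elim: Ints_cases)
  have "(T - t) / \<epsilon>\<^sup>2 > 0"
    using assms by simp
  then have "k > 0"
    by (simp add: k)
  then obtain n where n: "k = int (Suc n)"
    by (metis gr0_implies_Suc zero_less_imp_eq_int)
  have "(T - (t + \<epsilon>\<^sup>2)) / \<epsilon>\<^sup>2 = (T - t) / \<epsilon>\<^sup>2 - 1"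
    using assms(1) by (simp add: diff_divide_distrib add_divide_distrib)
  then have "(T - (t + \<epsilon>\<^sup>2)) / \<epsilon>\<^sup>2 = of_int (int n)"
    by (simp add: k n)
  then have "nat \<lfloor>(T - (t + \<epsilon>\<^sup>2)) / \<epsilon>\<^sup>2\<rfloor> = n"
    by (simp only: floor_of_int nat_int)
  moreover have "nat \<lfloor>(T - t) / \<epsilon>\<^sup>2\<rfloor> = Suc n"
    by (simp only: k n floor_of_int nat_int)
  ultimately show ?thesis
    by (simp only: value_fun_def value_steps.simps)
qed

section \<open>The partial differential equation\<close>

definition D_t :: "(real \<Rightarrow> real \<Rightarrow> real \<Rightarrow> real) \<Rightarrow> real \<Rightarrow> real \<Rightarrow> real \<Rightarrow> real" where
  "D_t v = (\<lambda>t \<xi> \<eta>. deriv (\<lambda>s. v s \<xi> \<eta>) t)"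

definition D_xi :: "(real \<Rightarrow> real \<Rightarrow> real \<Rightarrow> real) \<Rightarrow> real \<Rightarrow> real \<Rightarrow> real \<Rightarrow> real" where
  "D_xi v = (\<lambda>t \<xi> \<eta>. deriv (\<lambda>x. v t x \<eta>) \<xi>)"

definition D_eta :: "(real \<Rightarrow> real \<Rightarrow> real \<Rightarrow> real) \<Rightarrow> real \<Rightarrow> real \<Rightarrow> real \<Rightarrow> real" where
  "D_eta v = (\<lambda>t \<xi> \<eta>. deriv (\<lambda>y. v t \<xi> y) \<eta>)"

definition perp_grad :: "(real \<Rightarrow> real \<Rightarrow> real \<Rightarrow> real) \<Rightarrow> real \<Rightarrow> real \<Rightarrow> real \<Rightarrow> real^2" where
  "perp_grad u t \<xi> \<eta> = vector [- D_eta u t \<xi> \<eta>, D_xi u t \<xi> \<eta>]"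

definition hessian :: "(real \<Rightarrow> real \<Rightarrow> real \<Rightarrow> real) \<Rightarrow> real \<Rightarrow> real \<Rightarrow> real \<Rightarrow> real^2^2" where
  "hessian u t \<xi> \<eta> =
     vector [vector [D_xi (D_xi u) t \<xi> \<eta>, D_xi (D_eta u) t \<xi> \<eta>],
             vector [D_eta (D_xi u) t \<xi> \<eta>, D_eta (D_eta u) t \<xi> \<eta>]]"

text \<open>The final condition includes that \<open>u\<close> is continuous up to \<open>t = T\<close>; otherwise it would not
  relate \<open>\<phi>\<close> to the values of \<open>u\<close> at times \<open>t < T\<close>.\<close>

definition solves_final_value_problem ::
  "real \<Rightarrow> real \<Rightarrow> (real \<Rightarrow> real \<Rightarrow> real) \<Rightarrow> (real \<Rightarrow> real \<Rightarrow> real \<Rightarrow> real) \<Rightarrow> bool" where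
  "solves_final_value_problem A T \<phi> u \<longleftrightarrow>
     (\<forall>t \<xi> \<eta>. t < T \<longrightarrow>
        (let w = perp_grad u t \<xi> \<eta> /\<^sub>R D_eta u t \<xi> \<eta>
         in D_t u t \<xi> \<eta> + 1/2 * A * ((hessian u t \<xi> \<eta> *v w) \<bullet> w) = 0)) \<and>
     (\<forall>\<xi> \<eta>. u T \<xi> \<eta> = \<phi> \<xi> \<eta>) \<and>
     continuous_on ({..T} \<times> UNIV \<times> UNIV) (\<lambda>(t, \<xi>, \<eta>). u t \<xi> \<eta>)"

definition bounded_continuous_before ::
  "real \<Rightarrow> real \<Rightarrow> (real \<Rightarrow> real \<Rightarrow> real \<Rightarrow> real) \<Rightarrow> bool" where
  "bounded_continuous_before K T v \<longleftrightarrow>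
     continuous_on ({..<T} \<times> UNIV \<times> UNIV) (\<lambda>(t, \<xi>, \<eta>). v t \<xi> \<eta>) \<and>
     (\<forall>t \<xi> \<eta>. t < T \<longrightarrow> \<bar>v t \<xi> \<eta>\<bar> \<le> K)"

definition t_differentiable_before :: "real \<Rightarrow> (real \<Rightarrow> real \<Rightarrow> real \<Rightarrow> real) \<Rightarrow> bool" where
  "t_differentiable_before T v \<longleftrightarrow>
     (\<forall>t \<xi> \<eta>. t < T \<longrightarrow> (\<lambda>s. v s \<xi> \<eta>) field_differentiable at t)"

definition space_differentiable_before :: "real \<Rightarrow> (real \<Rightarrow> real \<Rightarrow> real \<Rightarrow> real) \<Rightarrow> bool" where
  "space_differentiable_before T v \<longleftrightarrow>
     (\<forall>t \<xi> \<eta>. t < T \<longrightarrow> (\<lambda>x. v t x \<eta>) field_differentiable at \<xi> \<and>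
                      (\<lambda>y. v t \<xi> y) field_differentiable at \<eta>)"

text \<open>All partial derivatives of \<open>v\<close> in \<open>(\<xi>, \<eta>)\<close> of order \<open>0, \<dots>, k\<close>, in any order of differentiation,
  exist and are continuous and bounded by \<open>K\<close> at times before \<open>T\<close>.\<close>

primrec bounded_space_derivs ::
  "nat \<Rightarrow> real \<Rightarrow> real \<Rightarrow> (real \<Rightarrow> real \<Rightarrow> real \<Rightarrow> real) \<Rightarrow> bool" where
  "bounded_space_derivs 0 K T v \<longleftrightarrow> bounded_continuous_before K T v"
| "bounded_space_derivs (Suc k) K T v \<longleftrightarrow>
     bounded_continuous_before K T v \<and> space_differentiable_before T v \<and>
     bounded_space_derivs k K T (D_xi v) \<and> bounded_space_derivs k K T (D_eta v)"

text \<open>The space derivatives of \<open>u\<close> are those of orders 1 to 4: \<open>u\<close> itself cannot be bounded when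
  \<open>u\<^sub>\<eta>\<close> is bounded below by a positive constant. For \<open>u\<^sub>t\<close> order 0 is included.\<close>

definition regular_solution :: "real \<Rightarrow> real \<Rightarrow> (real \<Rightarrow> real \<Rightarrow> real \<Rightarrow> real) \<Rightarrow> bool" where
  "regular_solution K T u \<longleftrightarrow>
     space_differentiable_before T u \<and>
     bounded_space_derivs 3 K T (D_xi u) \<and> bounded_space_derivs 3 K T (D_eta u) \<and>
     t_differentiable_before T u \<and> bounded_space_derivs 2 K T (D_t u) \<and>
     t_differentiable_before T (D_t u) \<and> bounded_continuous_before K T (D_t (D_t u))"

end

theory Submission
  imports Defs
begin

text \<open>
  The investor keeps the state close to the level curves of \<open>u\<close>. Write \<open>\<sigma> = q m - r m\<close>,
  \<open>\<rho> = q m + r m - 2 f\<close> and let \<open>A\<close> be the value of the linear program. If \<open>f\<close> is chosen such that the jump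
  \<open>\<epsilon> b (\<sigma>, \<rho>)\<close> is tangent to the level curve of \<open>u\<close>, then \<open>u\<close> changes only at second order, by
  \<open>\<epsilon>\<^sup>2 \<sigma>\<^sup>2 Q / 2\<close> with \<open>Q\<close> the quadratic form of the equation, while \<open>u\<^sub>t = - A Q / 2\<close>. The two do not balance
  state by state, since \<open>\<sigma>\<^sup>2\<close> depends on \<open>m\<close>. Balance is restored by two corrections.
  A tilt of \<open>f\<close> of order \<open>\<epsilon>\<close> changes \<open>u\<close> by \<open>- b \<epsilon>\<^sup>2 \<beta>\<^sub>m Q / 2\<close>, and a term \<open>\<epsilon>\<^sup>2 h(m) Q / 2\<close> is
  added to \<open>u\<close>, where \<open>h(m\<^sub>b) + \<sigma>\<^sup>2 - b \<beta>\<^sub>m - A \<le> h(m)\<close> for all states \<open>m\<close> and outcomes \<open>b\<close>.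
  Since \<open>Q \<ge> 0\<close>, the corrected
  function is then non-increasing up to an error \<open>O(\<epsilon>\<^sup>3)\<close> per step (\<open>corrected_step\<close>). It dominates the
  value function by induction over the steps (\<open>value_steps_le\<close>), of which there are \<open>(T - t) / \<epsilon>\<^sup>2\<close>.

  The potential \<open>h\<close> is found explicitly. The random walk on the graph is uniform after \<open>d\<close>
  steps, so \<open>h\<close> can be obtained by a finite sum from the Poisson equation
  \<open>h(m) - (h(m\<^sub>+) + h(m\<^sub>-)) / 2 = \<sigma>\<^sup>2 - \<mu>\<close>, where \<open>\<mu>\<close> is the mean of \<open>\<sigma>\<^sup>2\<close> over all states; with \<open>\<beta>\<^sub>m\<close> half
  the difference of \<open>h\<close> at the two successors, the inequality above holds with equality and \<open>\<mu>\<close> in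
  place of \<open>A\<close> (\<open>potential_exists\<close>). It remains to see that \<open>\<mu> \<le> A\<close> (\<open>mean_sq_le_lp_value\<close>), which also
  gives \<open>A > 0\<close> and thus \<open>Q = - 2 u\<^sub>t / A \<ge> 0\<close>. For this the constraints are summed over a decomposition
  of all arcs into simple cycles: the arcs are the words of length \<open>d + 1\<close>, and the rotation orbits of
  these words are simple cycles (\<open>cycle_rotation_cycle\<close>).
\<close>

section \<open>Rotation cycles cover the de Bruijn graph evenly\<close>

lemma finite_states: "finite (states d)"
  using finite_lists_length_eq[of "UNIV :: bool set" d] by (simp add: states_def)

lemma card_states: "card (states d) = 2 ^ d"
  using card_lists_length_eq[of "UNIV :: bool set" d] by (simp add: states_def)

lemma next_state_in_states: "m \<in> states d \<Longrightarrow> 1 \<le> d \<Longrightarrow> next_state m b \<in> states d"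
  by (simp add: states_def next_state_def)

lemma sum_states_snoc:
  fixes F :: "bool list \<Rightarrow> real"
  shows "(\<Sum>w\<in>states (Suc d). F w) = (\<Sum>m\<in>states d. F (m @ [True]) + F (m @ [False]))"
proof -
  have "(\<Sum>w\<in>states (Suc d). F w) = (\<Sum>(m, b)\<in>states d \<times> UNIV. F (m @ [b]))"
  proof (rule sum.reindex_bij_witness[where i = "\<lambda>(m, b). m @ [b]" and j = "\<lambda>w. (butlast w, last w)"])
    show "(case (butlast w, last w) of (m, b) \<Rightarrow> m @ [b]) = w" if "w \<in> states (Suc d)" for w
      using that by (cases w rule: rev_cases) (auto simp: states_def)
  qed (auto simp: states_def, metis append_butlast_last_id list.size(3) nat.distinct(1))
  also have "\<dots> = (\<Sum>m\<in>states d. \<Sum>b\<in>UNIV. F (m @ [b]))"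
    by (simp add: sum.cartesian_product)
  finally show ?thesis
    by (simp add: UNIV_bool add.commute)
qed

lemma sum_states_Cons:
  fixes F :: "bool list \<Rightarrow> real"
  shows "(\<Sum>w\<in>states (Suc d). F w) = (\<Sum>m\<in>states d. F (True # m)) + (\<Sum>m\<in>states d. F (False # m))"
proof -
  have "(\<Sum>w\<in>states (Suc d). F w) = (\<Sum>(m, b)\<in>states d \<times> UNIV. F (b # m))"
  proof (rule sum.reindex_bij_witness[where i = "\<lambda>(m, b). b # m" and j = "\<lambda>w. (tl w, hd w)"])
    show "(case (tl w, hd w) of (m, b) \<Rightarrow> b # m) = w" if "w \<in> states (Suc d)" for w
      using that by (cases w) (auto simp: states_def)
  qed (auto simp: states_def, metis list.collapse list.size(3) nat.distinct(1))
  also have "\<dots> = (\<Sum>m\<in>states d. \<Sum>b\<in>UNIV. F (b # m))"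
    by (simp add: sum.cartesian_product)
  finally show ?thesis
    by (simp add: UNIV_bool sum.distrib)
qed

lemma inj_rotate: "inj (rotate i :: 'a list \<Rightarrow> 'a list)"
proof -
  have "inj (rotate1 :: 'a list \<Rightarrow> 'a list)"
    by (rule injI) (metis length_rotate1 length_0_conv list.exhaust rotate1.simps(2) append1_eq_conv rotate1.simps(1) neq_Nil_conv)
  then show ?thesis
    unfolding rotate_def by (rule inj_fn)
qed

lemma sum_states_rotate:
  fixes F :: "bool list \<Rightarrow> real"
  shows "(\<Sum>w\<in>states n. F (rotate i w)) = (\<Sum>w\<in>states n. F w)"
proof -
  have "rotate i ` states n \<subseteq> states n"
    by (auto simp: states_def)
  moreover have inj: "inj_on (rotate i) (states n)"
    using inj_rotate by (rule inj_on_subset) simp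
  ultimately have "rotate i ` states n = states n"
    using finite_states endo_inj_surj by blast
  with inj have "bij_betw (rotate i) (states n) (states n)"
    by (simp add: bij_betw_def)
  then show ?thesis
    by (rule sum.reindex_bij_betw)
qed

text \<open>The arcs of the graph are the words of length \<open>d + 1\<close>: the arc from \<open>m\<close> with label \<open>b\<close> is \<open>m\<close>
  followed by \<open>b\<close>.\<close>

definition word_arc :: "bool list \<Rightarrow> bool list \<times> bool" where
  "word_arc w = (butlast w, last w)"

definition period :: "'a list \<Rightarrow> nat" where
  "period w = (LEAST p. 0 < p \<and> rotate p w = w)"

text \<open>The rotations of \<open>w\<close> by multiples of the period fix \<open>w\<close>, hence so does the rotation by the
  remainder of \<open>length w\<close>; minimality makes that remainder \<open>0\<close>.\<close>

lemma period_props: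
  assumes "w \<noteq> []"
  shows "0 < period w" "rotate (period w) w = w"
    "\<And>j. 0 < j \<Longrightarrow> j < period w \<Longrightarrow> rotate j w \<noteq> w"
    "period w dvd length w"
proof -
  have "0 < length w \<and> rotate (length w) w = w"
    using assms by simp
  then have *: "0 < period w \<and> rotate (period w) w = w"
    unfolding period_def by (rule LeastI)
  then show pos: "0 < period w" and eq: "rotate (period w) w = w"
    by auto
  show min: "rotate j w \<noteq> w" if "0 < j" "j < period w" for j
    using that not_less_Least unfolding period_def by blast
  have mult: "rotate (k * period w) w = w" for k
    by (induction k) (simp_all add: eq flip: rotate_rotate)
  have "rotate (length w mod period w) w = w"
    by (metis mult div_mult_mod_eq rotate_length01 rotate_rotate rotate_id mod_self add.commute)
  then show "period w dvd length w"
    using min[of "length w mod period w"] pos by (auto simp: dvd_eq_mod_eq_0)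
qed

definition rotation_cycle :: "bool list \<Rightarrow> (bool list \<times> bool) list" where
  "rotation_cycle w = map (\<lambda>i. word_arc (rotate i w)) [0..<period w]"

lemma head_word_arc:
  assumes "2 \<le> length w"
  shows "next_state (butlast w) (last w) = butlast (rotate1 w)"
proof -
  obtain a b v where "w = a # b # v"
    using assms by (auto simp: Suc_le_length_iff numeral_2_eq_2)
  then show ?thesis
    by (simp add: next_state_def butlast_append)
qed

lemma cas_rotations:
  assumes "2 \<le> length w"
  shows "pre_digraph.cas (de_bruijn d) (butlast (rotate i w))
    (map (\<lambda>i. word_arc (rotate i w)) [i..<i + k]) (butlast (rotate (i + k) w))"
proof (induction k arbitrary: i)
  case 0
  then show ?case by (simp add: pre_digraph.cas.simps)
next
  case (Suc k)
  have "[i..<i + Suc k] = i # [Suc i..<Suc i + k]"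
    by (simp add: upt_conv_Cons)
  moreover have "next_state (butlast (rotate i w)) (last (rotate i w)) = butlast (rotate (Suc i) w)"
    using assms by (simp add: head_word_arc)
  ultimately show ?case
    using Suc[of "Suc i"]
    by (simp add: pre_digraph.cas.simps word_arc_def de_bruijn_def)
qed

text \<open>Rotating a word by one place leads from an arc to one that starts where it ends, so a full
  period is a closed walk. It repeats no vertex: two rotations of \<open>w\<close> that agree in their first \<open>d\<close>
  letters agree in the last one too, because both have the letters of \<open>w\<close>; and distinct shifts
  within one period give distinct words.\<close>

lemma cycle_rotation_cycle:
  assumes "w \<in> states (Suc d)" "1 \<le> d"
  shows "pre_digraph.cycle (de_bruijn d) (rotation_cycle w)"
proof -
  have len: "length w = Suc d" and ne: "w \<noteq> []"
    using assms by (auto simp: states_def)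
  note p = period_props[OF ne]
  let ?c = "rotation_cycle w"
  have "set ?c \<subseteq> arcs (de_bruijn d)"
    using len by (auto simp: rotation_cycle_def word_arc_def de_bruijn_def states_def)
  moreover have "butlast w \<in> verts (de_bruijn d)"
    using len by (simp add: de_bruijn_def states_def)
  moreover have "pre_digraph.cas (de_bruijn d) (butlast w) ?c (butlast w)"
    using cas_rotations[of w d 0 "period w"] len assms(2) p(2) by (simp add: rotation_cycle_def)
  ultimately have walk: "pre_digraph.awalk (de_bruijn d) (butlast w) ?c (butlast w)"
    by (simp add: pre_digraph.awalk_def)
  have ne_c: "?c \<noteq> []"
    using p(1) by (simp add: rotation_cycle_def)
  have "last ?c = word_arc (rotate (period w - 1) w)"
    using p(1) by (simp add: rotation_cycle_def last_map)
  then have "head (de_bruijn d) (last ?c) = butlast (rotate (Suc (period w - 1)) w)"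
    using len assms(2) by (simp add: word_arc_def de_bruijn_def head_word_arc)
  then have hd_last: "head (de_bruijn d) (last ?c) = butlast (rotate (period w) w)"
    using p(1) by simp
  have "pre_digraph.awalk_verts (de_bruijn d) (butlast w) ?c
      = map (\<lambda>i. butlast (rotate i w)) [0..<period w] @ [butlast (rotate (period w) w)]"
    using ne_c hd_last
    by (simp add: pre_digraph.awalk_verts_conv)
       (simp add: rotation_cycle_def word_arc_def de_bruijn_def)
  also have "\<dots> = map (\<lambda>i. butlast (rotate i w)) [0..<Suc (period w)]"
    by simp
  finally have "tl (pre_digraph.awalk_verts (de_bruijn d) (butlast w) ?c)
      = map (\<lambda>i. butlast (rotate i w)) [1..<Suc (period w)]"
    by (simp flip: map_tl add: tl_upt del: upt_Suc)
  moreover have "inj_on (\<lambda>i. butlast (rotate i w)) (set [1..<Suc (period w)])"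
  proof (rule linorder_inj_onI)
    fix i j assume ij: "i < j" "i \<in> set [1..<Suc (period w)]" "j \<in> set [1..<Suc (period w)]"
    then have bounds: "i < j" "1 \<le> i" "j \<le> period w"
      by auto
    show "butlast (rotate i w) \<noteq> butlast (rotate j w)"
    proof
      assume eq: "butlast (rotate i w) = butlast (rotate j w)"
      have snoc: "rotate k w = butlast (rotate k w) @ [last (rotate k w)]" for k
        using ne by simp
      have "mset (rotate k w) = mset w" for k
        by (metis rotate_drop_take append_take_drop_id mset_append union_commute)
      then have "mset (rotate i w) = mset (rotate j w)"
        by simp
      then have "add_mset (last (rotate i w)) (mset (butlast (rotate i w)))
          = add_mset (last (rotate j w)) (mset (butlast (rotate j w)))"
        by (metis snoc mset_append mset_single_iff_right add_mset_add_single mset.simps)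
      then have "rotate i w = rotate j w"
        using eq snoc by (metis add_mset_eq_singleton_iff add_right_imp_eq add_mset_add_single add_left_imp_eq single_eq_single)
      also have "\<dots> = rotate i (rotate (j - i) w)"
        using ij by (simp add: rotate_rotate)
      finally have "rotate (j - i) w = w"
        using inj_rotate[of i] by (metis injD)
      then show False
        using p(3)[of "j - i"] bounds by linarith
    qed
  qed auto
  ultimately have "distinct (tl (pre_digraph.awalk_verts (de_bruijn d) (butlast w) ?c))"
    by (simp add: distinct_map del: upt_Suc)
  then show ?thesis
    using walk ne_c unfolding pre_digraph.cycle_def by blast
qed

text \<open>The arcs form an Eulerian graph, and the rotation orbits split it into simple cycles. To avoid
  choosing a representative of each orbit, every word of length \<open>d + 1\<close> is turned through \<open>d + 1\<close>
  places: this runs through its cycle a whole number of times, and over all words it meets each arc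
  exactly \<open>d + 1\<close> times.\<close>

lemma sum_arcs_nonpos:
  fixes wt :: "bool list \<times> bool \<Rightarrow> real"
  assumes "1 \<le> d" and cyc: "\<And>s. pre_digraph.cycle (de_bruijn d) s \<Longrightarrow> (\<Sum>a\<leftarrow>s. wt a) \<le> 0"
  shows "(\<Sum>m\<in>states d. wt (m, True) + wt (m, False)) \<le> 0"
proof -
  have turn: "(\<Sum>i<Suc d. wt (word_arc (rotate i w))) \<le> 0" if w: "w \<in> states (Suc d)" for w
  proof -
    have len: "length w = Suc d" and ne: "w \<noteq> []"
      using w by (auto simp: states_def)
    let ?p = "period w"
    note p = period_props[OF ne]
    obtain k where k: "Suc d = k * ?p"
      using p(4) len by (metis dvd_def mult.commute)
    have per: "rotate (i + l * ?p) w = rotate i w" for i l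
      by (induction l) (metis add_0_right mult_0, metis p(2) add.assoc add.commute mult_Suc rotate_rotate)
    have "(\<Sum>i<Suc d. wt (word_arc (rotate i w)))
        = (\<Sum>l<k. \<Sum>i\<in>{l * ?p..<l * ?p + ?p}. wt (word_arc (rotate i w)))"
      unfolding k by (rule sum.nat_group[symmetric])
    also have "\<dots> = (\<Sum>l<k. \<Sum>i<?p. wt (word_arc (rotate i w)))"
    proof (rule sum.cong[OF refl])
      fix l
      have "(\<Sum>i\<in>{l * ?p..<l * ?p + ?p}. wt (word_arc (rotate i w)))
          = (\<Sum>i\<in>{0..<?p}. wt (word_arc (rotate (i + l * ?p) w)))"
        using sum.shift_bounds_nat_ivl[of "\<lambda>i. wt (word_arc (rotate i w))" 0 "l * ?p" ?p]
        by (simp add: add.commute)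
      then show "(\<Sum>i\<in>{l * ?p..<l * ?p + ?p}. wt (word_arc (rotate i w)))
          = (\<Sum>i<?p. wt (word_arc (rotate i w)))"
        by (simp add: per atLeast0LessThan)
    qed
    also have "\<dots> = real k * (\<Sum>a\<leftarrow>rotation_cycle w. wt a)"
      by (simp add: rotation_cycle_def comp_def interv_sum_list_conv_sum_set_nat atLeast0LessThan)
    also have "\<dots> \<le> 0"
      using cyc[OF cycle_rotation_cycle[OF w assms(1)]] by (simp add: mult_nonneg_nonpos)
    finally show ?thesis .
  qed
  have "(1 + real d) * (\<Sum>w\<in>states (Suc d). wt (word_arc w))
      = (\<Sum>i<Suc d. \<Sum>w\<in>states (Suc d). wt (word_arc (rotate i w)))"
    using sum_states_rotate[where F = "\<lambda>w. wt (word_arc w)" and n = "Suc d"] by simp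
  also have "\<dots> = (\<Sum>w\<in>states (Suc d). \<Sum>i<Suc d. wt (word_arc (rotate i w)))"
    by (rule sum.swap)
  also have "\<dots> \<le> 0"
    using turn by (rule sum_nonpos)
  finally have "(\<Sum>w\<in>states (Suc d). wt (word_arc w)) \<le> 0"
    by (simp add: mult_le_0_iff)
  then show ?thesis
    by (simp add: sum_states_snoc word_arc_def)
qed

section \<open>The value of the linear program\<close>

definition mean_sq :: "nat \<Rightarrow> (bool list \<Rightarrow> real) \<Rightarrow> (bool list \<Rightarrow> real) \<Rightarrow> real" where
  "mean_sq d q r = (\<Sum>m\<in>states d. (q m - r m)\<^sup>2) / 2 ^ d"

text \<open>In the sum over all arcs, the two arcs leaving a state carry \<open>\<beta> m\<close> with opposite signs, so \<open>\<beta>\<close>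
  cancels.\<close>

lemma mean_sq_le_feasible:
  assumes "1 \<le> d" "lp_feasible d q r \<beta> M"
  shows "mean_sq d q r \<le> M"
proof -
  define wt where "wt = (\<lambda>(m, b). (q m - r m)\<^sup>2 - outcome b * \<beta> m - M)"
  have "(\<Sum>a\<leftarrow>s. wt a) \<le> 0" if "pre_digraph.cycle (de_bruijn d) s" for s
  proof -
    have "(\<Sum>a\<leftarrow>s. wt a) = (\<Sum>(m, b)\<leftarrow>s. (q m - r m)\<^sup>2 - outcome b * \<beta> m) - real (length s) * M"
      by (induction s) (auto simp: wt_def algebra_simps)
    then show ?thesis
      using assms(2) that by (auto simp: lp_feasible_def)
  qed
  from sum_arcs_nonpos[OF assms(1) this]
  have "(\<Sum>m\<in>states d. 2 * (q m - r m)\<^sup>2 - 2 * M) \<le> 0"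
    by (simp add: wt_def outcome_def)
  then have "(\<Sum>m\<in>states d. (q m - r m)\<^sup>2) \<le> 2 ^ d * M"
    by (simp add: sum_subtractf card_states flip: sum_distrib_left)
  then show ?thesis
    by (simp add: mean_sq_def field_simps)
qed

text \<open>A lower bound for all feasible \<open>M\<close> bounds their infimum as soon as some \<open>M\<close> is feasible;
  \<open>\<beta> = 0\<close> with the largest squared difference is.\<close>

lemma mean_sq_le_lp_value:
  assumes "1 \<le> d"
  shows "mean_sq d q r \<le> lp_value d q r"
  unfolding lp_value_def
proof (rule cInf_greatest)
  define M where "M = Max ((\<lambda>m. (q m - r m)\<^sup>2) ` states d)"
  have "(q m - r m)\<^sup>2 \<le> M" if "m \<in> states d" for m
    using that finite_states by (simp add: M_def)
  then have le: "(\<Sum>(m, b)\<leftarrow>s. (q m - r m)\<^sup>2 - outcome b * 0) \<le> real (length s) * M"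
    if "set s \<subseteq> states d \<times> UNIV" for s
    using that by (induction s) (auto simp: algebra_simps add_mono)
  have "lp_feasible d q r (\<lambda>_. 0) M"
    unfolding lp_feasible_def
  proof (intro allI impI)
    fix s assume "pre_digraph.cycle (de_bruijn d) s"
    then have "set s \<subseteq> states d \<times> UNIV"
      by (auto simp: pre_digraph.cycle_def pre_digraph.awalk_def de_bruijn_def)
    from le[OF this] show "(\<Sum>(m, b)\<leftarrow>s. (q m - r m)\<^sup>2 - outcome b * 0) \<le> real (length s) * M" .
  qed
  then show "{M. \<exists>\<beta>. lp_feasible d q r \<beta> M} \<noteq> {}"
    by blast
qed (use mean_sq_le_feasible[OF assms] in blast)

text \<open>The transition operator of the random walk that follows either arc with probability one half.\<close>

definition avg_next :: "(bool list \<Rightarrow> real) \<Rightarrow> bool list \<Rightarrow> real" where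
  "avg_next g m = (g (next_state m True) + g (next_state m False)) / 2"

text \<open>After \<open>k \<le> d\<close> steps of the walk the \<open>k\<close> oldest letters are gone and \<open>k\<close> uniformly random ones
  have been appended. In particular the walk is exactly uniform after \<open>d\<close> steps.\<close>

lemma avg_next_power:
  assumes "k \<le> d" "m \<in> states d"
  shows "(avg_next ^^ k) g m = (\<Sum>w\<in>states k. g (drop k m @ w)) / 2 ^ k"
  using assms
proof (induction k arbitrary: m)
  case 0
  have "states 0 = {[]}" by (auto simp: states_def)
  then show ?case by simp
next
  case (Suc k)
  have drop: "drop k (next_state m b) = drop (Suc k) m @ [b]" for b
    using Suc.prems by (simp add: next_state_def states_def drop_Suc)
  have "next_state m b \<in> states d" for b
    using Suc.prems by (intro next_state_in_states) auto
  then have "(avg_next ^^ Suc k) g m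
      = ((\<Sum>w\<in>states k. g (drop (Suc k) m @ [True] @ w)) / 2 ^ k
         + (\<Sum>w\<in>states k. g (drop (Suc k) m @ [False] @ w)) / 2 ^ k) / 2"
    using Suc.IH Suc.prems(1) by (simp add: drop avg_next_def[of "(avg_next ^^ k) g"])
  also have "\<dots> = (\<Sum>w\<in>states (Suc k). g (drop (Suc k) m @ w)) / 2 ^ Suc k"
    by (simp add: sum_states_Cons field_simps)
  finally show ?case .
qed

text \<open>Since the walk is uniform after \<open>d\<close> steps, the operator annihilates mean-zero functions in \<open>d\<close>
  steps, so the Neumann series for the Poisson equation is a finite sum. The choice of \<open>\<beta>\<close> as half
  the difference of the potential at the two successors makes both outcomes equally good for the
  market.\<close>

lemma potential_exists:
  assumes "1 \<le> d"
  shows "\<exists>h \<beta>. \<forall>m\<in>states d. \<forall>b.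
    h (next_state m b) + (q m - r m)\<^sup>2 - outcome b * \<beta> m - mean_sq d q r = h m"
proof -
  define g where "g = (\<lambda>m. (q m - r m)\<^sup>2 - mean_sq d q r)"
  define h where "h = (\<lambda>m. \<Sum>k<d. (avg_next ^^ k) g m)"
  have poisson: "h m - avg_next h m = g m" if m: "m \<in> states d" for m
  proof -
    have "avg_next h m = (\<Sum>k<d. (avg_next ^^ Suc k) g m)"
      by (simp add: h_def avg_next_def flip: sum.distrib sum_divide_distrib)
    then have "h m - avg_next h m = (\<Sum>k<d. (avg_next ^^ k) g m - (avg_next ^^ Suc k) g m)"
      by (simp add: h_def sum_subtractf)
    also have "\<dots> = g m - (avg_next ^^ d) g m"
      by (subst sum_lessThan_telescope') simp
    also have "(avg_next ^^ d) g m = 0"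
      using m avg_next_power[of d d m g]
      by (simp add: states_def g_def sum_subtractf mean_sq_def)
         (simp add: card_states[unfolded states_def])
    finally show ?thesis by simp
  qed
  have "h (next_state m b) + (q m - r m)\<^sup>2
      - outcome b * ((h (next_state m True) - h (next_state m False)) / 2) - mean_sq d q r = h m"
    if "m \<in> states d" for m b
    using poisson[OF that] by (cases b) (simp_all add: avg_next_def g_def outcome_def field_simps)
  then show ?thesis
    by (intro exI[of _ h] exI[of _ "\<lambda>m. (h (next_state m True) - h (next_state m False)) / 2"]) blast
qed

section \<open>Playing a fixed control in the dynamic programming principle\<close>

text \<open>An infimum over controls is below its value at one control only if the values are bounded
  below. The final data are bounded on compact sets, and one step moves each coordinate by at most
  \<open>4 \<bar>\<epsilon>\<bar>\<close>, so bounds on squares propagate through the recursion at the cost of a larger square.\<close>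

lemma value_steps_locally_bounded_below:
  assumes "continuous_on UNIV (\<lambda>(x, y). \<phi> x y)"
    and qr: "\<And>m. m \<in> states d \<Longrightarrow> \<bar>q m\<bar> \<le> 1 \<and> \<bar>r m\<bar> \<le> 1"
    and d: "\<And>m b. m \<in> states d \<Longrightarrow> next_state m b \<in> states d"
  shows "\<exists>L. \<forall>m\<in>states d. \<forall>x y. \<bar>x\<bar> \<le> R \<longrightarrow> \<bar>y\<bar> \<le> R \<longrightarrow> L \<le> value_steps q r \<phi> \<epsilon> n m x y"
proof (induction n arbitrary: R)
  case 0
  have "compact ((\<lambda>(x, y). \<phi> x y) ` ({-R..R} \<times> {-R..R}))"
    by (intro compact_continuous_image continuous_on_subset[OF assms(1)] compact_Times) auto
  then have "bdd_below ((\<lambda>(x, y). \<phi> x y) ` ({-R..R} \<times> {-R..R}))"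
    by (intro bounded_imp_bdd_below compact_imp_bounded)
  then obtain L where "\<forall>z\<in>{-R..R} \<times> {-R..R}. L \<le> (\<lambda>(x, y). \<phi> x y) z"
    by (auto simp: bdd_below_def)
  then have "L \<le> \<phi> x y" if "\<bar>x\<bar> \<le> R" "\<bar>y\<bar> \<le> R" for x y
    using that by (auto simp: abs_le_iff)
  then show ?case
    by auto
next
  case (Suc n)
  obtain L where L: "\<And>m x y. m \<in> states d \<Longrightarrow> \<bar>x\<bar> \<le> R + \<bar>\<epsilon>\<bar> * 4 \<Longrightarrow> \<bar>y\<bar> \<le> R + \<bar>\<epsilon>\<bar> * 4
      \<Longrightarrow> L \<le> value_steps q r \<phi> \<epsilon> n m x y"
    using Suc[of "R + \<bar>\<epsilon>\<bar> * 4"] by blast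
  have "L \<le> value_steps q r \<phi> \<epsilon> (Suc n) m x y"
    if m: "m \<in> states d" and xy: "\<bar>x\<bar> \<le> R" "\<bar>y\<bar> \<le> R" for m x y
    unfolding value_steps.simps
  proof (rule cINF_greatest)
    fix f :: real assume f: "f \<in> {-1..1}"
    have near: "\<bar>z + \<epsilon> * outcome b * s\<bar> \<le> R + \<bar>\<epsilon>\<bar> * 4" if "\<bar>z\<bar> \<le> R" "\<bar>s\<bar> \<le> 4" for z s b
    proof -
      have "\<bar>\<epsilon> * outcome b * s\<bar> = \<bar>\<epsilon>\<bar> * \<bar>s\<bar>"
        by (simp add: abs_mult outcome_def)
      also have "\<dots> \<le> \<bar>\<epsilon>\<bar> * 4"
        using that by (intro mult_left_mono) auto
      finally show ?thesis
        using that by linarith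
    qed
    have "\<bar>q m - r m\<bar> \<le> 4" "\<bar>q m + r m - 2 * f\<bar> \<le> 4"
      using qr[OF m] f by (auto simp: abs_le_iff)
    then have "L \<le> value_steps q r \<phi> \<epsilon> n (next_state m b)
         (x + \<epsilon> * outcome b * (q m - r m)) (y + \<epsilon> * outcome b * (q m + r m - 2 * f))" for b
      using near xy d[OF m] by (intro L) auto
    then show "L \<le> (MAX b. value_steps q r \<phi> \<epsilon> n (next_state m b)
         (x + \<epsilon> * outcome b * (q m - r m)) (y + \<epsilon> * outcome b * (q m + r m - 2 * f)))"
      by (subst Max_ge_iff) auto
  qed simp
  then show ?case
    by blast
qed

lemma value_steps_le_of_control:
  assumes "continuous_on UNIV (\<lambda>(x, y). \<phi> x y)"
    and qr: "\<And>m. m \<in> states d \<Longrightarrow> \<bar>q m\<bar> \<le> 1 \<and> \<bar>r m\<bar> \<le> 1"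
    and d: "\<And>m b. m \<in> states d \<Longrightarrow> next_state m b \<in> states d"
    and m: "m \<in> states d" and f: "f \<in> {-1..1}"
    and le: "\<And>b. value_steps q r \<phi> \<epsilon> n (next_state m b)
         (x + \<epsilon> * outcome b * (q m - r m)) (y + \<epsilon> * outcome b * (q m + r m - 2 * f)) \<le> V"
  shows "value_steps q r \<phi> \<epsilon> (Suc n) m x y \<le> V"
proof -
  let ?F = "\<lambda>f. MAX b. value_steps q r \<phi> \<epsilon> n (next_state m b)
         (x + \<epsilon> * outcome b * (q m - r m)) (y + \<epsilon> * outcome b * (q m + r m - 2 * f))"
  define R where "R = max \<bar>x\<bar> \<bar>y\<bar> + \<bar>\<epsilon>\<bar> * 4"
  obtain L where "\<forall>m\<in>states d. \<forall>x y. \<bar>x\<bar> \<le> R \<longrightarrow> \<bar>y\<bar> \<le> R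
      \<longrightarrow> L \<le> value_steps q r \<phi> \<epsilon> n m x y"
    using value_steps_locally_bounded_below[OF assms(1), of d q r R \<epsilon> n] qr d by blast
  then have L: "\<And>m x y. m \<in> states d \<Longrightarrow> \<bar>x\<bar> \<le> R \<Longrightarrow> \<bar>y\<bar> \<le> R
      \<Longrightarrow> L \<le> value_steps q r \<phi> \<epsilon> n m x y"
    by blast
  have "L \<le> ?F g" if g: "g \<in> {-1..1}" for g
  proof -
    have near: "\<bar>z + \<epsilon> * outcome True * s\<bar> \<le> R" if "\<bar>z\<bar> \<le> max \<bar>x\<bar> \<bar>y\<bar>" "\<bar>s\<bar> \<le> 4" for z s
    proof -
      have "\<bar>\<epsilon> * outcome True * s\<bar> \<le> \<bar>\<epsilon>\<bar> * 4"
        using that by (auto simp: abs_mult outcome_def intro: mult_left_mono)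
      then show ?thesis
        using that unfolding R_def by linarith
    qed
    have "\<bar>q m - r m\<bar> \<le> 4" "\<bar>q m + r m - 2 * g\<bar> \<le> 4"
      using qr[OF m] g by (auto simp: abs_le_iff)
    then have "L \<le> value_steps q r \<phi> \<epsilon> n (next_state m True)
         (x + \<epsilon> * outcome True * (q m - r m)) (y + \<epsilon> * outcome True * (q m + r m - 2 * g))"
      using near d[OF m] by (intro L) auto
    then show ?thesis
      by (subst Max_ge_iff) auto
  qed
  then have "bdd_below (?F ` {-1..1})"
    by (rule bdd_belowI2)
  then have "value_steps q r \<phi> \<epsilon> (Suc n) m x y \<le> ?F f"
    using f by (simp only: value_steps.simps) (rule cINF_lower)
  also have "?F f \<le> V"
    using le by (subst Max_le_iff) auto
  finally show ?thesis .
qed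

section \<open>Directional derivatives in space\<close>

text \<open>The \<open>n\<close>-th derivative of \<open>v\<close> along \<open>(\<sigma>, \<rho>)\<close>. The mixed derivatives in different orders enter as
  separate terms, as they do in the quadratic form of \<^const>\<open>hessian\<close>.\<close>

primrec dir_deriv :: "real \<Rightarrow> real \<Rightarrow> nat \<Rightarrow> (real \<Rightarrow> real \<Rightarrow> real \<Rightarrow> real) \<Rightarrow> real \<Rightarrow> real \<Rightarrow> real \<Rightarrow> real" where
  "dir_deriv \<sigma> \<rho> 0 v = v"
| "dir_deriv \<sigma> \<rho> (Suc n) v = (\<lambda>t x y. \<sigma> * dir_deriv \<sigma> \<rho> n (D_xi v) t x y + \<rho> * dir_deriv \<sigma> \<rho> n (D_eta v) t x y)"

lemma has_derivative_along_line:
  assumes t: "t < T" and diff: "space_differentiable_before T v"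
    and cont: "bounded_continuous_before K T (D_eta v)"
  shows "((\<lambda>\<tau>. v t (x + \<tau> * \<sigma>) (y + \<tau> * \<rho>)) has_real_derivative
    dir_deriv \<sigma> \<rho> 1 v t (x + \<tau> * \<sigma>) (y + \<tau> * \<rho>)) (at \<tau>)"
proof -
  let ?x = "x + \<tau> * \<sigma>" and ?y = "y + \<tau> * \<rho>"
  let ?a = "D_xi v t ?x ?y" and ?e = "D_eta v t ?x ?y"
  let ?fy = "\<lambda>x y. blinfun_scaleR_left (D_eta v t x y)"
  have "((\<lambda>x. v t x ?y) has_real_derivative ?a) (at ?x)"
    using diff t unfolding space_differentiable_before_def D_xi_def
    by (simp add: field_differentiable_derivI)
  then have 1: "((\<lambda>x. v t x ?y) has_derivative (*) ?a) (at ?x)"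
    by (simp add: has_field_derivative_def)
  have 2: "((\<lambda>y. v t x y) has_derivative blinfun_apply (?fy x y)) (at y)" for x y
  proof -
    have "((\<lambda>y. v t x y) has_real_derivative D_eta v t x y) (at y)"
      using diff t unfolding space_differentiable_before_def D_eta_def
      by (simp add: field_differentiable_derivI)
    moreover have "blinfun_apply (?fy x y) = (*) (D_eta v t x y)"
      by (auto simp: fun_eq_iff)
    ultimately show ?thesis
      by (simp add: has_field_derivative_def)
  qed
  have slice: "continuous_on UNIV (\<lambda>z :: real \<times> real. (t, fst z, snd z))"
    by (intro continuous_intros)
  have "continuous_on ({..<T} \<times> UNIV \<times> UNIV) (\<lambda>(t, x, y). D_eta v t x y)"
    using cont by (simp add: bounded_continuous_before_def)
  from continuous_on_compose2[OF this slice]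
  have "continuous_on UNIV (\<lambda>z. D_eta v t (fst z) (snd z))"
    using t by (simp add: case_prod_unfold image_subset_iff)
  then have "continuous_on UNIV (\<lambda>z. ?fy (fst z) (snd z))"
    by (rule bounded_linear.continuous_on[OF bounded_linear_blinfun_scaleR_left])
  then have 3: "continuous (at (?x, ?y) within UNIV \<times> UNIV) (\<lambda>(x, y). ?fy x y)"
    by (simp add: continuous_on_eq_continuous_at case_prod_unfold)
  have "((\<lambda>(x, y). v t x y) has_derivative (\<lambda>(tx, ty). ?a * tx + ?fy ?x ?y ty)) (at (?x, ?y) within UNIV \<times> UNIV)"
    by (rule has_derivative_partialsI[where X = UNIV and Y = UNIV]) (use 1 2 3 in simp_all)
  then have main: "((\<lambda>(x, y). v t x y) has_derivative (\<lambda>(tx, ty). ?a * tx + ?fy ?x ?y ty)) (at (?x, ?y))"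
    by simp
  have line: "((\<lambda>\<tau>. (x + \<tau> * \<sigma>, y + \<tau> * \<rho>)) has_derivative (\<lambda>h. (h * \<sigma>, h * \<rho>))) (at \<tau>)"
    by (auto intro!: derivative_eq_intros)
  have "((\<lambda>\<tau>. v t (x + \<tau> * \<sigma>) (y + \<tau> * \<rho>)) has_derivative
      (\<lambda>h. ?a * (h * \<sigma>) + ?fy ?x ?y (h * \<rho>))) (at \<tau>)"
    using has_derivative_compose[OF line main] by simp
  moreover have "(\<lambda>h. ?a * (h * \<sigma>) + ?fy ?x ?y (h * \<rho>)) = (*) (dir_deriv \<sigma> \<rho> 1 v t ?x ?y)"
    by (auto simp: fun_eq_iff algebra_simps)
  ultimately show ?thesis
    unfolding has_field_derivative_def by (simp only:)
qed

lemma dir_deriv_has_derivative: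
  assumes "t < T" "bounded_space_derivs (Suc n) K T v"
  shows "((\<lambda>\<tau>. dir_deriv \<sigma> \<rho> n v t (x + \<tau> * \<sigma>) (y + \<tau> * \<rho>)) has_real_derivative
    dir_deriv \<sigma> \<rho> (Suc n) v t (x + \<tau> * \<sigma>) (y + \<tau> * \<rho>)) (at \<tau>)"
  using assms(2)
proof (induction n arbitrary: v)
  case 0
  then have "bounded_continuous_before K T (D_eta v)" "space_differentiable_before T v"
    by simp_all
  from has_derivative_along_line[OF assms(1) this(2,1)] show ?case
    by simp
next
  case (Suc n)
  then have "bounded_space_derivs (Suc n) K T (D_xi v)" "bounded_space_derivs (Suc n) K T (D_eta v)"
    by simp_all
  from Suc.IH[OF this(1)] Suc.IH[OF this(2)] show ?case
    unfolding dir_deriv.simps(2)[of _ _ "Suc n" v] dir_deriv.simps(2)[of _ _ n v]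
    by (intro DERIV_add DERIV_cmult)
qed

lemma abs_dir_deriv_le:
  assumes "t < T" "bounded_space_derivs n K T v"
  shows "\<bar>dir_deriv \<sigma> \<rho> n v t x y\<bar> \<le> (\<bar>\<sigma>\<bar> + \<bar>\<rho>\<bar>) ^ n * K"
  using assms(2)
proof (induction n arbitrary: v)
  case 0
  then show ?case
    using assms(1) by (simp add: bounded_continuous_before_def)
next
  case (Suc n)
  have "\<bar>dir_deriv \<sigma> \<rho> (Suc n) v t x y\<bar>
      \<le> \<bar>\<sigma>\<bar> * \<bar>dir_deriv \<sigma> \<rho> n (D_xi v) t x y\<bar> + \<bar>\<rho>\<bar> * \<bar>dir_deriv \<sigma> \<rho> n (D_eta v) t x y\<bar>"
    by (simp flip: abs_mult)
  also have "\<dots> \<le> \<bar>\<sigma>\<bar> * ((\<bar>\<sigma>\<bar> + \<bar>\<rho>\<bar>) ^ n * K) + \<bar>\<rho>\<bar> * ((\<bar>\<sigma>\<bar> + \<bar>\<rho>\<bar>) ^ n * K)"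
    using Suc by (intro add_mono mult_left_mono) simp_all
  finally show ?case
    by (simp add: algebra_simps)
qed

lemma taylor_along_line:
  assumes "\<And>m \<tau>. m < n \<Longrightarrow> ((\<lambda>\<tau>. dir_deriv \<sigma> \<rho> m v t (x + \<tau> * \<sigma>) (y + \<tau> * \<rho>)) has_real_derivative
      dir_deriv \<sigma> \<rho> (Suc m) v t (x + \<tau> * \<sigma>) (y + \<tau> * \<rho>)) (at \<tau>)"
    and "\<And>x y. \<bar>dir_deriv \<sigma> \<rho> n v t x y\<bar> \<le> B"
  shows "\<bar>v t (x + \<tau> * \<sigma>) (y + \<tau> * \<rho>) - (\<Sum>m<n. dir_deriv \<sigma> \<rho> m v t x y / fact m * \<tau> ^ m)\<bar>
    \<le> B / fact n * \<bar>\<tau>\<bar> ^ n"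
proof -
  let ?D = "\<lambda>m \<tau>. dir_deriv \<sigma> \<rho> m v t (x + \<tau> * \<sigma>) (y + \<tau> * \<rho>)"
  have "\<exists>s. \<bar>s\<bar> \<le> \<bar>\<tau>\<bar> \<and> ?D 0 \<tau> = (\<Sum>m<n. ?D m 0 / fact m * \<tau> ^ m) + ?D n s / fact n * \<tau> ^ n"
    by (rule Maclaurin_bi_le) (use assms(1) in auto)
  then obtain s where "?D 0 \<tau> = (\<Sum>m<n. ?D m 0 / fact m * \<tau> ^ m) + ?D n s / fact n * \<tau> ^ n"
    by blast
  then have "\<bar>v t (x + \<tau> * \<sigma>) (y + \<tau> * \<rho>) - (\<Sum>m<n. dir_deriv \<sigma> \<rho> m v t x y / fact m * \<tau> ^ m)\<bar>
      = \<bar>?D n s\<bar> / fact n * \<bar>\<tau>\<bar> ^ n"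
    by (simp add: abs_mult power_abs)
  also have "\<dots> \<le> B / fact n * \<bar>\<tau>\<bar> ^ n"
    using assms(2) by (intro mult_right_mono divide_right_mono) auto
  finally show ?thesis .
qed

text \<open>The direction \<open>(\<sigma>, \<rho>)\<close> with this \<open>\<rho>\<close> is \<open>- \<sigma>\<close> times the vector \<open>\<nabla>\<^sup>\<bottom>u / u\<^sub>\<eta>\<close> that enters the equation;
  it is tangent to the level curve of \<open>u\<close>.\<close>

lemma pde_on_level_direction:
  assumes "solves_final_value_problem A T \<phi> u" "t < T" "D_eta u t x y \<noteq> 0"
    and "\<rho> = - \<sigma> * D_xi u t x y / D_eta u t x y"
  shows "A * dir_deriv \<sigma> \<rho> 2 u t x y = - 2 * \<sigma>\<^sup>2 * D_t u t x y"
proof -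
  let ?z = "D_xi u t x y / D_eta u t x y"
  let ?w = "perp_grad u t x y /\<^sub>R D_eta u t x y"
  have "?w $ 1 = - 1" "?w $ 2 = ?z"
    using assms(3) by (simp_all add: perp_grad_def field_simps)
  then have form: "(hessian u t x y *v ?w) \<bullet> ?w
      = D_xi (D_xi u) t x y - (D_xi (D_eta u) t x y + D_eta (D_xi u) t x y) * ?z
        + D_eta (D_eta u) t x y * ?z\<^sup>2"
    by (simp add: inner_vec_def matrix_vector_mult_def sum_2 hessian_def power2_eq_square algebra_simps del: vector_scaleR_component)
  have "D_t u t x y + 1 / 2 * A * ((hessian u t x y *v ?w) \<bullet> ?w) = 0"
    using assms(1,2) unfolding solves_final_value_problem_def Let_def by blast
  then have "A * ((hessian u t x y *v ?w) \<bullet> ?w) = - 2 * D_t u t x y"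
    by simp
  then have "\<sigma>\<^sup>2 * (A * ((hessian u t x y *v ?w) \<bullet> ?w)) = \<sigma>\<^sup>2 * (- 2 * D_t u t x y)"
    by (rule arg_cong)
  then have "A * (\<sigma>\<^sup>2 * ((hessian u t x y *v ?w) \<bullet> ?w)) = \<sigma>\<^sup>2 * (- 2 * D_t u t x y)"
    by (simp only: mult.left_commute)
  moreover have "dir_deriv \<sigma> \<rho> 2 u t x y = \<sigma>\<^sup>2 * ((hessian u t x y *v ?w) \<bullet> ?w)"
    unfolding form using assms(4)
    by (simp add: numeral_2_eq_2 power2_eq_square algebra_simps)
  ultimately show ?thesis
    by (simp only: mult.left_commute mult.assoc mult.commute)
qed

lemma bounded_space_derivs_mono:
  "bounded_space_derivs n K T v \<Longrightarrow> k \<le> n \<Longrightarrow> bounded_space_derivs k K T v"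
proof (induction n arbitrary: k v)
  case (Suc n)
  show ?case
  proof (cases k)
    case 0
    then show ?thesis using Suc.prems by simp
  next
    case (Suc j)
    then show ?thesis using Suc.prems Suc.IH by simp
  qed
qed simp

lemma dir_deriv_has_derivative_regular:
  assumes reg: "regular_solution K T u" and t: "t < T" and n: "n \<le> 3"
  shows "((\<lambda>\<tau>. dir_deriv \<sigma> \<rho> n u t (x + \<tau> * \<sigma>) (y + \<tau> * \<rho>)) has_real_derivative
    dir_deriv \<sigma> \<rho> (Suc n) u t (x + \<tau> * \<sigma>) (y + \<tau> * \<rho>)) (at \<tau>)"
proof (cases n)
  case 0
  have "space_differentiable_before T u" "bounded_space_derivs 0 K T (D_eta u)"
    using reg bounded_space_derivs_mono[of 3 K T _ 0] by (auto simp: regular_solution_def)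
  then show ?thesis
    using has_derivative_along_line[OF t] 0 by simp
next
  case (Suc k)
  then have "bounded_space_derivs (Suc k) K T (D_xi u)" "bounded_space_derivs (Suc k) K T (D_eta u)"
    using reg n bounded_space_derivs_mono[of 3 K T _ "Suc k"] by (auto simp: regular_solution_def)
  from dir_deriv_has_derivative[OF t this(1)] dir_deriv_has_derivative[OF t this(2)] show ?thesis
    unfolding Suc dir_deriv.simps(2)[of _ _ "Suc k" u] dir_deriv.simps(2)[of _ _ k u]
    by (intro DERIV_add DERIV_cmult)
qed

lemma abs_dir_deriv_regular_le:
  assumes reg: "regular_solution K T u" and t: "t < T" and n: "n \<le> 3"
  shows "\<bar>dir_deriv \<sigma> \<rho> (Suc n) u t x y\<bar> \<le> (\<bar>\<sigma>\<bar> + \<bar>\<rho>\<bar>) ^ Suc n * K"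
proof -
  have bd: "bounded_space_derivs n K T (D_xi u)" "bounded_space_derivs n K T (D_eta u)"
    using reg n bounded_space_derivs_mono[of 3 K T _ n] by (auto simp: regular_solution_def)
  have "\<bar>dir_deriv \<sigma> \<rho> (Suc n) u t x y\<bar>
      \<le> \<bar>\<sigma>\<bar> * \<bar>dir_deriv \<sigma> \<rho> n (D_xi u) t x y\<bar> + \<bar>\<rho>\<bar> * \<bar>dir_deriv \<sigma> \<rho> n (D_eta u) t x y\<bar>"
    by (simp flip: abs_mult)
  also have "\<dots> \<le> \<bar>\<sigma>\<bar> * ((\<bar>\<sigma>\<bar> + \<bar>\<rho>\<bar>) ^ n * K) + \<bar>\<rho>\<bar> * ((\<bar>\<sigma>\<bar> + \<bar>\<rho>\<bar>) ^ n * K)"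
    using abs_dir_deriv_le[OF t bd(1)] abs_dir_deriv_le[OF t bd(2)] by (intro add_mono mult_left_mono) simp_all
  finally show ?thesis
    by (simp add: algebra_simps)
qed

section \<open>The potential-corrected solution along the investor's strategy\<close>

text \<open>What the comparison with \<open>u\<close> uses: bounds on the experts, a solution \<open>(h, \<beta>)\<close> of the inequality
  that makes \<open>h\<close> a potential for the linear program at level \<open>A\<close>, and the regularity of \<open>u\<close>.\<close>

locale controlled_solution =
  fixes d :: nat and q r h \<beta> :: "bool list \<Rightarrow> real" and A B H \<kappa> K c T :: real
    and \<phi> :: "real \<Rightarrow> real \<Rightarrow> real" and u :: "real \<Rightarrow> real \<Rightarrow> real \<Rightarrow> real"
  assumes next_state: "\<And>m b. m \<in> states d \<Longrightarrow> next_state m b \<in> states d"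
    and expert_bound: "\<And>m. m \<in> states d \<Longrightarrow> \<bar>q m\<bar> \<le> \<kappa> \<and> \<bar>r m\<bar> \<le> \<kappa>" and \<kappa>: "\<kappa> \<le> 1"
    and A: "A > 0" and c: "c > 0"
    and potential: "\<And>m b. m \<in> states d \<Longrightarrow>
      h (next_state m b) + (q m - r m)\<^sup>2 - outcome b * \<beta> m - A \<le> h m"
    and h_bound: "\<And>m. m \<in> states d \<Longrightarrow> \<bar>h m\<bar> \<le> H"
    and \<beta>_bound: "\<And>m. m \<in> states d \<Longrightarrow> \<bar>\<beta> m\<bar> \<le> B"
    and pde: "solves_final_value_problem A T \<phi> u"
    and regular: "regular_solution K T u"
    and eta_gt: "\<And>t x y. t < T \<Longrightarrow> D_eta u t x y > c"
    and xi_le: "\<And>t x y. t < T \<Longrightarrow> \<bar>D_xi u t x y\<bar> \<le> D_eta u t x y"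
    and decreasing: "\<And>t x y. t < T \<Longrightarrow> D_t u t x y \<le> 0"
begin

lemma nonneg: "K \<ge> 0" "B \<ge> 0" "H \<ge> 0"
proof -
  have "bounded_continuous_before K T (D_t (D_t u))"
    using regular by (simp add: regular_solution_def)
  then have "\<bar>D_t (D_t u) (T - 1) 0 0\<bar> \<le> K"
    by (simp add: bounded_continuous_before_def)
  then show "K \<ge> 0" by linarith
  have "replicate d True \<in> states d" by (simp add: states_def)
  then show "B \<ge> 0" "H \<ge> 0"
    using \<beta>_bound h_bound by (meson abs_ge_zero order_trans)+
qed

lemma abs_D_t_le: "t < T \<Longrightarrow> \<bar>D_t u t x y\<bar> \<le> K"
  using regular by (auto simp: regular_solution_def numeral_2_eq_2 bounded_continuous_before_def)

definition \<Delta> :: real where "\<Delta> = B * K / (A * c)"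

lemma \<Delta>_nonneg: "\<Delta> \<ge> 0"
  using nonneg A c by (simp add: \<Delta>_def)

text \<open>With \<open>tilt = 0\<close> the control below would move the state along the level curve of \<open>u\<close>, and \<open>u\<close> would
  change only at second order. The tilt, of size at most \<open>\<Delta>\<close>, adds the first-order change
  \<open>b \<epsilon>\<^sup>2 \<beta>\<^sub>m u\<^sub>t / A\<close>, which is what charges or credits the outcome \<open>b\<close> as the linear program prescribes.\<close>

definition tilt :: "real \<Rightarrow> bool list \<Rightarrow> real \<Rightarrow> real \<Rightarrow> real" where
  "tilt t m x y = \<beta> m * D_t u t x y / (A * D_eta u t x y)"

lemma abs_tilt_le:
  assumes "t < T" "m \<in> states d"
  shows "\<bar>tilt t m x y\<bar> \<le> \<Delta>"
proof -
  have e: "D_eta u t x y > c"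
    using assms eta_gt by blast
  have "\<bar>tilt t m x y\<bar> = \<bar>\<beta> m\<bar> * \<bar>D_t u t x y\<bar> / (A * D_eta u t x y)"
    using e c A by (simp add: tilt_def abs_mult)
  also have "\<dots> \<le> B * K / (A * c)"
    using e c A nonneg \<beta>_bound[OF assms(2)] abs_D_t_le[OF assms(1)]
    by (intro frac_le mult_mono) auto
  finally show ?thesis
    by (simp add: \<Delta>_def)
qed

definition control :: "real \<Rightarrow> real \<Rightarrow> bool list \<Rightarrow> real \<Rightarrow> real \<Rightarrow> real" where
  "control \<epsilon> t m x y =
     (q m + r m + (q m - r m) * D_xi u t x y / D_eta u t x y - \<epsilon> * tilt t m x y) / 2"

text \<open>Without the tilt, twice the control is \<open>(1 + z) q + (1 - z) r\<close> for \<open>z = u\<^sub>\<xi> / u\<^sub>\<eta>\<close>. As \<open>\<bar>z\<bar> \<le> 1\<close>, the control is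
  then a convex combination of the experts' positions, hence at most \<open>\<kappa>\<close> in size; the room up to \<open>1\<close>
  is left for the tilt.\<close>

lemma control_admissible:
  assumes t: "t < T" and m: "m \<in> states d" and \<epsilon>: "0 < \<epsilon>" "\<epsilon> * \<Delta> \<le> 2 * (1 - \<kappa>)"
  shows "control \<epsilon> t m x y \<in> {-1..1}"
proof -
  define z where "z = D_xi u t x y / D_eta u t x y"
  have "D_eta u t x y > 0"
    using eta_gt[OF t, of x y] c by simp
  then have z: "\<bar>z\<bar> \<le> 1"
    using xi_le[OF t, of x y] by (simp add: z_def)
  have "\<bar>q m + r m + (q m - r m) * z\<bar> = \<bar>q m * (1 + z) + r m * (1 - z)\<bar>"
    by (simp add: algebra_simps)
  also have "\<dots> \<le> \<bar>q m\<bar> * (1 + z) + \<bar>r m\<bar> * (1 - z)"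
    using z by (intro order_trans[OF abs_triangle_ineq]) (simp add: abs_mult)
  also have "\<dots> \<le> \<kappa> * (1 + z) + \<kappa> * (1 - z)"
    using z expert_bound[OF m] by (intro add_mono mult_right_mono) auto
  finally have "\<bar>q m + r m + (q m - r m) * z\<bar> \<le> 2 * \<kappa>"
    by (simp add: algebra_simps)
  moreover have "\<bar>\<epsilon> * tilt t m x y\<bar> \<le> \<epsilon> * \<Delta>"
    using \<epsilon> abs_tilt_le[OF t m] by (simp add: abs_mult)
  ultimately show ?thesis
    using \<epsilon>(2) by (auto simp: control_def z_def abs_le_iff field_simps)
qed

lemma abs_jump_le:
  assumes "m \<in> states d" "f \<in> {-1..1}"
  shows "\<bar>q m - r m\<bar> \<le> 2" "\<bar>q m + r m - 2 * f\<bar> \<le> 4"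
  using expert_bound[OF assms(1)] \<kappa> assms(2) by (auto simp: abs_le_iff)

lemma D_t_lipschitz_space:
  assumes t: "t < T" and "\<bar>\<sigma>\<bar> + \<bar>\<rho>\<bar> \<le> 6"
  shows "\<bar>D_t u t (x + \<tau> * \<sigma>) (y + \<tau> * \<rho>) - D_t u t x y\<bar> \<le> 6 * K * \<bar>\<tau>\<bar>"
proof -
  have bd: "bounded_space_derivs 1 K T (D_t u)"
    using regular bounded_space_derivs_mono[of 2 K T _ 1] by (auto simp: regular_solution_def)
  have "\<bar>D_t u t (x + \<tau> * \<sigma>) (y + \<tau> * \<rho>) - (\<Sum>m<1. dir_deriv \<sigma> \<rho> m (D_t u) t x y / fact m * \<tau> ^ m)\<bar>
      \<le> 6 * K / fact 1 * \<bar>\<tau>\<bar> ^ 1"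
  proof (rule taylor_along_line)
    show "\<bar>dir_deriv \<sigma> \<rho> 1 (D_t u) t x y\<bar> \<le> 6 * K" for x y
      using abs_dir_deriv_le[OF t bd, of \<sigma> \<rho> x y] mult_right_mono[OF assms(2) nonneg(1)] by simp
  qed (use dir_deriv_has_derivative[OF t, of 0 K "D_t u"] bd in simp)
  then show ?thesis by simp
qed

lemma D_t_lipschitz_time:
  assumes "s < T" "t < s"
  shows "\<bar>D_t u s x y - D_t u t x y\<bar> \<le> K * (s - t)"
proof -
  have "((\<lambda>s. D_t u s x y) has_real_derivative D_t (D_t u) z x y) (at z)" if "z < T" for z
    using regular that unfolding regular_solution_def t_differentiable_before_def D_t_def[of "D_t u"]
    by (simp add: field_differentiable_derivI)
  then obtain z where z: "t < z" "z < s" "D_t u s x y - D_t u t x y = (s - t) * D_t (D_t u) z x y"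
    using MVT2[OF assms(2), of "\<lambda>s. D_t u s x y" "\<lambda>z. D_t (D_t u) z x y"] assms by auto
  have "\<bar>D_t (D_t u) z x y\<bar> \<le> K"
    using regular z assms by (auto simp: regular_solution_def bounded_continuous_before_def)
  then show ?thesis
    using z assms by (simp add: abs_mult mult.commute)
qed

lemma u_has_time_derivative:
  "t < T \<Longrightarrow> ((\<lambda>s. u s x y) has_real_derivative D_t u t x y) (at t)"
  using regular unfolding regular_solution_def t_differentiable_before_def D_t_def
  by (simp add: field_differentiable_derivI)

lemma time_step:
  assumes "s < T" "t < s"
  shows "u s x y \<le> u t x y + (s - t) * D_t u t x y + K * (s - t)\<^sup>2"
proof -
  obtain z where z: "t < z" "z < s" "u s x y - u t x y = (s - t) * D_t u z x y"
    using MVT2[OF assms(2), of "\<lambda>s. u s x y" "\<lambda>z. D_t u z x y"] assms u_has_time_derivative by auto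
  have "D_t u z x y \<le> D_t u t x y + K * (z - t)"
    using D_t_lipschitz_time[of z t x y] z assms by auto
  also have "\<dots> \<le> D_t u t x y + K * (s - t)"
    using z nonneg by (simp add: mult_left_mono)
  finally have "(s - t) * D_t u z x y \<le> (s - t) * (D_t u t x y + K * (s - t))"
    using assms by (intro mult_left_mono) auto
  then show ?thesis
    using z by (simp add: algebra_simps power2_eq_square)
qed

text \<open>No derivative of \<open>u\<close> is known at the final time, so the last step relies on monotonicity in time
  and on continuity up to \<open>T\<close> only.\<close>

lemma final_step:
  assumes "t < T"
  shows "\<phi> x y \<le> u t x y"
proof -
  have "continuous_on ({..T} \<times> UNIV \<times> UNIV) (\<lambda>(t, x, y). u t x y)"
    using pde by (simp add: solves_final_value_problem_def)
  moreover have "continuous_on {t..T} (\<lambda>s. (s, x, y))"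
    by (intro continuous_intros)
  ultimately have "continuous_on {t..T} (\<lambda>s. case (s, x, y) of (t, x, y) \<Rightarrow> u t x y)"
    by (rule continuous_on_compose2) auto
  then have "continuous_on {t..T} (\<lambda>s. u s x y)"
    by simp
  then have "u T x y \<le> u t x y"
    using assms u_has_time_derivative decreasing
    by (intro DERIV_nonpos_imp_decreasing_open[where f = "\<lambda>s. u s x y"]) (simp, blast)
  then show ?thesis
    using pde by (simp add: solves_final_value_problem_def)
qed

text \<open>Taylor expansion to third order. The first-order term is produced by the tilt alone; the
  second-order term is that of the level direction, known from the equation, up to \<open>O(\<epsilon>)\<close> caused by
  the tilt. A jump has \<open>\<bar>\<sigma>\<bar> + \<bar>\<rho>\<bar> \<le> 6\<close>, which gives the remainder \<open>6\<^sup>3 K \<epsilon>\<^sup>3 / 3! = 36 K \<epsilon>\<^sup>3\<close>.\<close>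

lemma space_step:
  fixes x y :: real
  assumes t: "t < T" and m: "m \<in> states d" and \<epsilon>: "0 < \<epsilon>" "\<epsilon> * \<Delta> \<le> 2 * (1 - \<kappa>)"
  defines "\<rho> \<equiv> q m + r m - 2 * control \<epsilon> t m x y"
  shows "u t (x + \<epsilon> * outcome b * (q m - r m)) (y + \<epsilon> * outcome b * \<rho>)
    \<le> u t x y + \<epsilon>\<^sup>2 * (outcome b * \<beta> m - (q m - r m)\<^sup>2) * D_t u t x y / A
      + (36 + 5 * \<Delta>) * K * \<epsilon> ^ 3"
proof -
  define \<sigma> where "\<sigma> = q m - r m"
  define e where "e = D_eta u t x y"
  define a where "a = D_xi u t x y"
  define U where "U = D_t u t x y"
  define \<delta> where "\<delta> = tilt t m x y"
  define \<tau> where "\<tau> = \<epsilon> * outcome b"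
  define \<rho>\<^sub>0 where "\<rho>\<^sub>0 = - \<sigma> * a / e"
  have e: "e > 0"
    using eta_gt[OF t, of x y] c by (simp add: e_def)
  have "2 * control \<epsilon> t m x y = q m + r m + \<sigma> * a / e - \<epsilon> * \<delta>"
    by (simp add: control_def \<sigma>_def \<delta>_def a_def e_def)
  then have \<rho>: "\<rho> = \<rho>\<^sub>0 + \<epsilon> * \<delta>"
    by (simp add: \<rho>_def \<rho>\<^sub>0_def)
  have \<tau>2: "\<tau>\<^sup>2 = \<epsilon>\<^sup>2" and \<tau>abs: "\<bar>\<tau>\<bar> = \<epsilon>" and \<tau>\<epsilon>: "\<tau> * \<epsilon> = \<epsilon>\<^sup>2 * outcome b"
    using \<epsilon> by (auto simp: \<tau>_def outcome_def power2_eq_square)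
  have size: "\<bar>\<sigma>\<bar> \<le> 2" "\<bar>\<rho>\<bar> \<le> 4"
    using abs_jump_le[OF m control_admissible[OF t m \<epsilon>]] by (auto simp: \<sigma>_def \<rho>_def)
  have "\<bar>a / e\<bar> \<le> 1"
    using xi_le[OF t, of x y] e by (simp add: a_def e_def)
  then have "\<bar>\<sigma>\<bar> * \<bar>a / e\<bar> \<le> 2 * 1"
    using size by (intro mult_mono) auto
  then have size0: "\<bar>\<rho>\<^sub>0\<bar> \<le> 2"
    by (simp add: \<rho>\<^sub>0_def abs_mult)
  have "\<bar>u t (x + \<tau> * \<sigma>) (y + \<tau> * \<rho>) - (\<Sum>m<3. dir_deriv \<sigma> \<rho> m u t x y / fact m * \<tau> ^ m)\<bar>
      \<le> 216 * K / fact 3 * \<bar>\<tau>\<bar> ^ 3"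
  proof (rule taylor_along_line)
    have "(\<bar>\<sigma>\<bar> + \<bar>\<rho>\<bar>) ^ 3 \<le> 6 ^ 3"
      using size by (intro power_mono) auto
    then have "(\<bar>\<sigma>\<bar> + \<bar>\<rho>\<bar>) ^ 3 * K \<le> 216 * K"
      using nonneg by (intro mult_right_mono) auto
    then show "\<bar>dir_deriv \<sigma> \<rho> 3 u t x y\<bar> \<le> 216 * K" for x y
      using abs_dir_deriv_regular_le[OF regular t, of 2 \<sigma> \<rho> x y] by (simp add: numeral_3_eq_3)
  qed (use dir_deriv_has_derivative_regular[OF regular t] in auto)
  moreover have "(\<Sum>m<3. dir_deriv \<sigma> \<rho> m u t x y / fact m * \<tau> ^ m)
      = u t x y + \<tau> * dir_deriv \<sigma> \<rho> 1 u t x y + \<tau>\<^sup>2 / 2 * dir_deriv \<sigma> \<rho> 2 u t x y"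
  proof -
    have "{..<3::nat} = {0, 1, 2}" by auto
    then show ?thesis by (simp del: dir_deriv.simps(2))
  qed
  ultimately have taylor: "u t (x + \<tau> * \<sigma>) (y + \<tau> * \<rho>)
      \<le> u t x y + \<tau> * dir_deriv \<sigma> \<rho> 1 u t x y + \<tau>\<^sup>2 / 2 * dir_deriv \<sigma> \<rho> 2 u t x y + 36 * K * \<epsilon> ^ 3"
    by (simp add: \<tau>abs fact_numeral abs_le_iff del: dir_deriv.simps(2))
  have first: "dir_deriv \<sigma> \<rho> 1 u t x y = \<epsilon> * \<beta> m * U / A"
  proof -
    have "dir_deriv \<sigma> \<rho> 1 u t x y = \<sigma> * a + \<rho>\<^sub>0 * e + \<epsilon> * (\<delta> * e)"
      by (simp add: \<rho> a_def e_def algebra_simps)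
    also have "\<sigma> * a + \<rho>\<^sub>0 * e = 0"
      using e by (simp add: \<rho>\<^sub>0_def)
    also have "\<delta> * e = \<beta> m * U / A"
      using e by (simp add: \<delta>_def tilt_def U_def flip: e_def)
    finally show ?thesis by simp
  qed
  have second: "dir_deriv \<sigma> \<rho> 2 u t x y \<le> - 2 * \<sigma>\<^sup>2 * U / A + 10 * K * \<Delta> * \<epsilon>"
  proof -
    let ?xe = "D_xi (D_eta u) t x y + D_eta (D_xi u) t x y" and ?ee = "D_eta (D_eta u) t x y"
    have "bounded_space_derivs 1 K T (D_xi u)" "bounded_space_derivs 1 K T (D_eta u)"
      using regular bounded_space_derivs_mono[of 3 K T _ 1] by (auto simp: regular_solution_def)
    then have bds: "\<bar>D_xi (D_eta u) t x y\<bar> \<le> K" "\<bar>D_eta (D_xi u) t x y\<bar> \<le> K" "\<bar>?ee\<bar> \<le> K"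
      using t by (auto simp: bounded_continuous_before_def)
    have "A * dir_deriv \<sigma> \<rho>\<^sub>0 2 u t x y = - 2 * \<sigma>\<^sup>2 * U"
      unfolding U_def using e by (intro pde_on_level_direction[OF pde t]) (auto simp: e_def a_def \<rho>\<^sub>0_def)
    then have lead: "dir_deriv \<sigma> \<rho>\<^sub>0 2 u t x y = - 2 * \<sigma>\<^sup>2 * U / A"
      using A by (simp add: field_simps)
    have "dir_deriv \<sigma> \<rho> 2 u t x y - dir_deriv \<sigma> \<rho>\<^sub>0 2 u t x y = \<epsilon> * \<delta> * (\<sigma> * ?xe + (\<rho> + \<rho>\<^sub>0) * ?ee)"
      by (simp add: numeral_2_eq_2 \<rho> algebra_simps)
    also have "\<dots> \<le> \<bar>\<epsilon> * \<delta>\<bar> * \<bar>\<sigma> * ?xe + (\<rho> + \<rho>\<^sub>0) * ?ee\<bar>"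
      by (metis abs_ge_self abs_mult)
    also have "\<dots> \<le> (\<epsilon> * \<Delta>) * (10 * K)"
    proof (rule mult_mono)
      show "\<bar>\<epsilon> * \<delta>\<bar> \<le> \<epsilon> * \<Delta>"
        using \<epsilon> abs_tilt_le[OF t m] by (simp add: abs_mult \<delta>_def)
      have "\<bar>\<sigma> * ?xe\<bar> \<le> 2 * (2 * K)"
        unfolding abs_mult using size bds nonneg by (intro mult_mono) auto
      moreover have "\<bar>(\<rho> + \<rho>\<^sub>0) * ?ee\<bar> \<le> 6 * K"
        unfolding abs_mult using size size0 bds nonneg by (intro mult_mono) auto
      ultimately show "\<bar>\<sigma> * ?xe + (\<rho> + \<rho>\<^sub>0) * ?ee\<bar> \<le> 10 * K"
        by linarith
    qed (use \<epsilon> \<Delta>_nonneg in auto)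
    finally show ?thesis
      unfolding lead by (simp add: algebra_simps)
  qed
  have "u t (x + \<tau> * \<sigma>) (y + \<tau> * \<rho>)
      \<le> u t x y + \<tau> * (\<epsilon> * \<beta> m * U / A) + \<epsilon>\<^sup>2 / 2 * (- 2 * \<sigma>\<^sup>2 * U / A + 10 * K * \<Delta> * \<epsilon>) + 36 * K * \<epsilon> ^ 3"
  proof -
    have "\<epsilon>\<^sup>2 / 2 * dir_deriv \<sigma> \<rho> 2 u t x y \<le> \<epsilon>\<^sup>2 / 2 * (- 2 * \<sigma>\<^sup>2 * U / A + 10 * K * \<Delta> * \<epsilon>)"
      using second by (rule mult_left_mono) simp
    then show ?thesis
      using taylor unfolding first \<tau>2 by linarith
  qed
  also have "\<tau> * (\<epsilon> * \<beta> m * U / A) = \<epsilon>\<^sup>2 * outcome b * \<beta> m * U / A"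
    using \<tau>\<epsilon> by (metis mult.assoc times_divide_eq_right)
  also have "u t x y + \<epsilon>\<^sup>2 * outcome b * \<beta> m * U / A
        + \<epsilon>\<^sup>2 / 2 * (- 2 * \<sigma>\<^sup>2 * U / A + 10 * K * \<Delta> * \<epsilon>) + 36 * K * \<epsilon> ^ 3
      = u t x y + \<epsilon>\<^sup>2 * (outcome b * \<beta> m - \<sigma>\<^sup>2) * U / A + (36 + 5 * \<Delta>) * K * \<epsilon> ^ 3"
    using A by (simp add: field_simps power2_eq_square power3_eq_cube)
  finally show ?thesis
    by (simp only: U_def \<sigma>_def \<tau>_def)
qed

text \<open>The coefficient \<open>43\<close> consists of \<open>36\<close> from the Taylor expansion in space, \<open>6\<close> from the variation of
  \<open>u\<^sub>t\<close> over a jump and \<open>1\<close> from the expansion in time; the last two also make the \<open>7\<close>, which bounds the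
  variation of \<open>u\<^sub>t\<close> over a whole step.\<close>

definition step_const :: real where
  "step_const = (43 + 5 * \<Delta> + 7 * H / A) * K"

text \<open>Along the control, \<open>u - \<epsilon>\<^sup>2 h u\<^sub>t / A\<close> grows by at most \<open>O(\<epsilon>\<^sup>3)\<close>, whatever the market does. The
  terms of order \<open>\<epsilon>\<^sup>2\<close> add up to \<open>- u\<^sub>t / A\<close> times the two sides of the potential inequality, and
  \<open>- u\<^sub>t / A \<ge> 0\<close> by monotonicity in time. By the equation, \<open>- u\<^sub>t / A\<close> is half the quadratic form of the
  Hessian; writing the correction with \<open>u\<^sub>t\<close> means that its Lipschitz bounds come directly from the
  bounds on the derivatives of \<open>u\<^sub>t\<close>.\<close>

lemma corrected_step:
  fixes x y :: real and b :: bool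
  assumes t: "t + \<epsilon>\<^sup>2 < T" and m: "m \<in> states d"
    and \<epsilon>: "0 < \<epsilon>" "\<epsilon> \<le> 1" "\<epsilon> * \<Delta> \<le> 2 * (1 - \<kappa>)"
  defines "x' \<equiv> x + \<epsilon> * outcome b * (q m - r m)"
    and "y' \<equiv> y + \<epsilon> * outcome b * (q m + r m - 2 * control \<epsilon> t m x y)"
  shows "u (t + \<epsilon>\<^sup>2) x' y' - \<epsilon>\<^sup>2 * h (next_state m b) * D_t u (t + \<epsilon>\<^sup>2) x' y' / A
    \<le> u t x y - \<epsilon>\<^sup>2 * h m * D_t u t x y / A + step_const * \<epsilon> ^ 3"
proof -
  define U where "U = D_t u t x y"
  define h' where "h' = h (next_state m b)"
  have "\<epsilon>\<^sup>2 > 0"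
    using \<epsilon> by simp
  with t have tT: "t < T"
    by linarith
  have U: "U \<le> 0"
    using decreasing[OF tT] by (simp add: U_def)
  have \<epsilon>4: "\<epsilon> ^ 4 \<le> \<epsilon> ^ 3" and \<epsilon>2: "\<epsilon>\<^sup>2 \<le> \<epsilon>"
    using \<epsilon> power_decreasing[of 3 4 \<epsilon>] power_decreasing[of 1 2 \<epsilon>] by auto
  have "\<bar>\<epsilon> * outcome b\<bar> = \<epsilon>"
    using \<epsilon> by (simp add: outcome_def)
  moreover have "\<bar>q m - r m\<bar> + \<bar>q m + r m - 2 * control \<epsilon> t m x y\<bar> \<le> 6"
    using abs_jump_le[OF m control_admissible[OF tT m \<epsilon>(1,3), of x y]] by linarith
  ultimately have lip: "\<bar>D_t u t x' y' - U\<bar> \<le> 6 * K * \<epsilon>"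
    unfolding U_def x'_def y'_def using D_t_lipschitz_space[OF tT] by metis
  have "u (t + \<epsilon>\<^sup>2) x' y' \<le> u t x' y' + \<epsilon>\<^sup>2 * D_t u t x' y' + K * \<epsilon> ^ 4"
    using time_step[OF t, of t x' y'] \<epsilon> by simp
  also have "\<dots> \<le> u t x' y' + \<epsilon>\<^sup>2 * (U + 6 * K * \<epsilon>) + K * \<epsilon> ^ 3"
    using lip \<epsilon>4 nonneg by (intro add_mono mult_left_mono order_refl) auto
  also have "\<dots> \<le> (u t x y + \<epsilon>\<^sup>2 * (outcome b * \<beta> m - (q m - r m)\<^sup>2) * U / A + (36 + 5 * \<Delta>) * K * \<epsilon> ^ 3)
      + \<epsilon>\<^sup>2 * (U + 6 * K * \<epsilon>) + K * \<epsilon> ^ 3"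
    using space_step[OF tT m \<epsilon>(1,3), of x b y] unfolding x'_def y'_def U_def by simp
  finally have main: "u (t + \<epsilon>\<^sup>2) x' y' \<le> u t x y
      + \<epsilon>\<^sup>2 * (outcome b * \<beta> m - (q m - r m)\<^sup>2) * U / A + \<epsilon>\<^sup>2 * U + (43 + 5 * \<Delta>) * K * \<epsilon> ^ 3"
    by (simp add: algebra_simps power2_eq_square power3_eq_cube)
  have "\<bar>D_t u (t + \<epsilon>\<^sup>2) x' y' - D_t u t x' y'\<bar> \<le> K * \<epsilon>\<^sup>2"
    using D_t_lipschitz_time[OF t, of t x' y'] \<epsilon> by simp
  also have "K * \<epsilon>\<^sup>2 \<le> K * \<epsilon>"
    using \<epsilon>2 nonneg by (intro mult_left_mono)
  finally have drift: "\<bar>D_t u (t + \<epsilon>\<^sup>2) x' y' - U\<bar> \<le> 7 * K * \<epsilon>"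
    using lip by linarith
  have "\<bar>h' * (D_t u (t + \<epsilon>\<^sup>2) x' y' - U)\<bar> \<le> H * (7 * K * \<epsilon>)"
    unfolding abs_mult h'_def using drift h_bound[OF next_state[OF m]] nonneg by (intro mult_mono) auto
  then have "- h' * D_t u (t + \<epsilon>\<^sup>2) x' y' \<le> - h' * U + H * (7 * K * \<epsilon>)"
    by (simp add: algebra_simps abs_le_iff)
  then have "\<epsilon>\<^sup>2 / A * (- h' * D_t u (t + \<epsilon>\<^sup>2) x' y') \<le> \<epsilon>\<^sup>2 / A * (- h' * U + H * (7 * K * \<epsilon>))"
    using A by (intro mult_left_mono) auto
  moreover have "\<epsilon>\<^sup>2 / A * (- h' * D_t u (t + \<epsilon>\<^sup>2) x' y') = - (\<epsilon>\<^sup>2 * h' * D_t u (t + \<epsilon>\<^sup>2) x' y' / A)"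
    by simp
  moreover have "\<epsilon>\<^sup>2 / A * (- h' * U + H * (7 * K * \<epsilon>)) = - (\<epsilon>\<^sup>2 * h' * U / A) + 7 * H / A * K * \<epsilon> ^ 3"
    using A by (simp add: field_simps power2_eq_square power3_eq_cube)
  ultimately have corr: "- (\<epsilon>\<^sup>2 * h' * D_t u (t + \<epsilon>\<^sup>2) x' y' / A)
      \<le> - (\<epsilon>\<^sup>2 * h' * U / A) + 7 * H / A * K * \<epsilon> ^ 3"
    by linarith
  have "- h m \<le> A + outcome b * \<beta> m - (q m - r m)\<^sup>2 - h'"
    using potential[OF m, of b] by (simp add: h'_def)
  then have "(A + outcome b * \<beta> m - (q m - r m)\<^sup>2 - h') * U \<le> - h m * U"
    using U by (rule mult_right_mono_neg)
  then have "\<epsilon>\<^sup>2 / A * ((A + outcome b * \<beta> m - (q m - r m)\<^sup>2 - h') * U) \<le> \<epsilon>\<^sup>2 / A * (- h m * U)"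
    using A by (intro mult_left_mono) auto
  moreover have "\<epsilon>\<^sup>2 / A * ((A + outcome b * \<beta> m - (q m - r m)\<^sup>2 - h') * U)
      = \<epsilon>\<^sup>2 * (outcome b * \<beta> m - (q m - r m)\<^sup>2) * U / A + \<epsilon>\<^sup>2 * U - \<epsilon>\<^sup>2 * h' * U / A"
    using A by (simp add: field_simps)
  ultimately have "\<epsilon>\<^sup>2 * (outcome b * \<beta> m - (q m - r m)\<^sup>2) * U / A + \<epsilon>\<^sup>2 * U - \<epsilon>\<^sup>2 * h' * U / A
      \<le> - (\<epsilon>\<^sup>2 * h m * U / A)"
    by simp
  then have "u (t + \<epsilon>\<^sup>2) x' y' - \<epsilon>\<^sup>2 * h' * D_t u (t + \<epsilon>\<^sup>2) x' y' / A
      \<le> u t x y - \<epsilon>\<^sup>2 * h m * U / A + ((43 + 5 * \<Delta>) * K * \<epsilon> ^ 3 + 7 * H / A * K * \<epsilon> ^ 3)"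
    using main corr by linarith
  also have "(43 + 5 * \<Delta>) * K * \<epsilon> ^ 3 + 7 * H / A * K * \<epsilon> ^ 3 = step_const * \<epsilon> ^ 3"
    by (simp only: step_const_def distrib_right)
  finally show ?thesis
    by (simp add: U_def h'_def)
qed

definition last_step_const :: real where
  "last_step_const = ((B + 4 + H) / A + 36 + 5 * \<Delta>) * K"

lemma abs_correction_le:
  assumes t: "t < T" and m: "m \<in> states d"
  shows "\<bar>\<epsilon>\<^sup>2 * h m * D_t u t x y / A\<bar> \<le> \<epsilon>\<^sup>2 * (H / A * K)"
proof -
  have "\<bar>\<epsilon>\<^sup>2 * h m * D_t u t x y / A\<bar> = \<epsilon>\<^sup>2 * (\<bar>h m\<bar> * \<bar>D_t u t x y\<bar> / A)"
    using A by (simp add: abs_mult)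
  also have "\<dots> \<le> \<epsilon>\<^sup>2 * (H * K / A)"
    using A h_bound[OF m] abs_D_t_le[OF t] nonneg
    by (intro mult_left_mono divide_right_mono mult_mono) auto
  finally show ?thesis by simp
qed

lemma continuous_final_data: "continuous_on UNIV (\<lambda>(x, y). \<phi> x y)"
proof -
  have slice: "continuous_on UNIV (\<lambda>z :: real \<times> real. (T, fst z, snd z))"
    by (intro continuous_intros)
  have "continuous_on ({..T} \<times> UNIV \<times> UNIV) (\<lambda>(t, x, y). u t x y)"
    using pde by (simp add: solves_final_value_problem_def)
  from continuous_on_compose2[OF this slice] have "continuous_on UNIV (\<lambda>z. u T (fst z) (snd z))"
    by (simp add: case_prod_unfold image_subset_iff)
  then show ?thesis
    using pde by (simp add: solves_final_value_problem_def case_prod_unfold)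
qed

text \<open>The step into the final time happens once, so an error of order \<open>\<epsilon>\<^sup>2\<close> is affordable, and the
  second-order terms are merely bounded.\<close>

lemma last_step:
  fixes x y :: real and b :: bool
  assumes t: "t < T" and m: "m \<in> states d"
    and \<epsilon>: "0 < \<epsilon>" "\<epsilon> \<le> 1" "\<epsilon> * \<Delta> \<le> 2 * (1 - \<kappa>)"
  shows "\<phi> (x + \<epsilon> * outcome b * (q m - r m))
      (y + \<epsilon> * outcome b * (q m + r m - 2 * control \<epsilon> t m x y))
    \<le> u t x y - \<epsilon>\<^sup>2 * h m * D_t u t x y / A + last_step_const * \<epsilon>\<^sup>2"
proof -
  let ?p = "outcome b * \<beta> m - (q m - r m)\<^sup>2"
  have "\<bar>q m - r m\<bar> \<le> 2"
    using expert_bound[OF m] \<kappa> by (auto simp: abs_le_iff)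
  then have "\<bar>q m - r m\<bar>\<^sup>2 \<le> 2\<^sup>2"
    by (intro power_mono) auto
  then have sq: "\<bar>(q m - r m)\<^sup>2\<bar> \<le> 4"
    by simp
  have "\<bar>outcome b * \<beta> m\<bar> \<le> B"
    using \<beta>_bound[OF m] by (simp add: outcome_def)
  then have p: "\<bar>?p\<bar> \<le> B + 4"
    using sq by linarith
  have "?p * D_t u t x y \<le> \<bar>?p\<bar> * \<bar>D_t u t x y\<bar>"
    by (metis abs_ge_self abs_mult)
  also have "\<dots> \<le> (B + 4) * K"
    using p abs_D_t_le[OF t] nonneg by (intro mult_mono) auto
  finally have "\<epsilon>\<^sup>2 / A * (?p * D_t u t x y) \<le> \<epsilon>\<^sup>2 / A * ((B + 4) * K)"
    using A by (intro mult_left_mono) auto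
  then have first: "\<epsilon>\<^sup>2 * ?p * D_t u t x y / A \<le> (B + 4) / A * K * \<epsilon>\<^sup>2"
    by (simp add: field_simps)
  have "\<epsilon> ^ 3 \<le> \<epsilon>\<^sup>2"
    using \<epsilon> power_decreasing[of 2 3 \<epsilon>] by auto
  then have second: "(36 + 5 * \<Delta>) * K * \<epsilon> ^ 3 \<le> (36 + 5 * \<Delta>) * K * \<epsilon>\<^sup>2"
    using nonneg \<Delta>_nonneg by (intro mult_left_mono) auto
  have third: "\<epsilon>\<^sup>2 * h m * D_t u t x y / A \<le> H / A * K * \<epsilon>\<^sup>2"
    using abs_le_D1[OF abs_correction_le[OF t m, of \<epsilon> x y]] by (simp add: mult.commute)
  have "last_step_const * \<epsilon>\<^sup>2
      = (B + 4) / A * K * \<epsilon>\<^sup>2 + H / A * K * \<epsilon>\<^sup>2 + (36 + 5 * \<Delta>) * K * \<epsilon>\<^sup>2"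
    by (simp add: last_step_const_def add_divide_distrib algebra_simps)
  then show ?thesis
    using order_trans[OF final_step[OF t] space_step[OF t m \<epsilon>(1,3), of x b y]] first second third
    by linarith
qed

lemma value_steps_le:
  assumes \<epsilon>: "0 < \<epsilon>" "\<epsilon> \<le> 1" "\<epsilon> * \<Delta> \<le> 2 * (1 - \<kappa>)" and m: "m \<in> states d"
    and t: "t = T - real (Suc n) * \<epsilon>\<^sup>2"
  shows "value_steps q r \<phi> \<epsilon> (Suc n) m x y
    \<le> u t x y - \<epsilon>\<^sup>2 * h m * D_t u t x y / A + last_step_const * \<epsilon>\<^sup>2 + real n * (step_const * \<epsilon> ^ 3)"
  using m t
proof (induction n arbitrary: t m x y)
  case (0 t m x y)
  have "t < T"
    using 0 \<epsilon> by simp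
  then show ?case
    using 0 last_step[OF _ 0(1) \<epsilon>] control_admissible[OF _ 0(1) \<epsilon>(1,3)] expert_bound \<kappa>
    by (intro value_steps_le_of_control[OF continuous_final_data _ next_state 0(1),
          where f = "control \<epsilon> t m x y"]) fastforce+
next
  case (Suc n t m x y)
  have t': "t + \<epsilon>\<^sup>2 = T - real (Suc n) * \<epsilon>\<^sup>2"
    using Suc.prems(2) by (simp add: algebra_simps)
  moreover have "\<epsilon>\<^sup>2 > 0"
    using \<epsilon> by simp
  ultimately have tT: "t + \<epsilon>\<^sup>2 < T"
    by (simp add: add_pos_nonneg)
  then have "t < T"
    using \<open>\<epsilon>\<^sup>2 > 0\<close> by linarith
  show ?case
  proof (rule value_steps_le_of_control[OF continuous_final_data _ next_state Suc.prems(1)])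
    show "control \<epsilon> t m x y \<in> {-1..1}"
      by (rule control_admissible[OF \<open>t < T\<close> Suc.prems(1) \<epsilon>(1,3)])
    show "\<bar>q m\<bar> \<le> 1 \<and> \<bar>r m\<bar> \<le> 1" if "m \<in> states d" for m
      using expert_bound[OF that] \<kappa> by linarith
    fix b
    let ?x = "x + \<epsilon> * outcome b * (q m - r m)"
    let ?y = "y + \<epsilon> * outcome b * (q m + r m - 2 * control \<epsilon> t m x y)"
    have "real (Suc n) * (step_const * \<epsilon> ^ 3) = real n * (step_const * \<epsilon> ^ 3) + step_const * \<epsilon> ^ 3"
      by (simp add: algebra_simps)
    then show "value_steps q r \<phi> \<epsilon> (Suc n) (next_state m b) ?x ?y
        \<le> u t x y - \<epsilon>\<^sup>2 * h m * D_t u t x y / A + last_step_const * \<epsilon>\<^sup>2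
          + real (Suc n) * (step_const * \<epsilon> ^ 3)"
      using Suc.IH[OF next_state[OF Suc.prems(1), of b] t', of ?x ?y]
        corrected_step[OF tT Suc.prems(1) \<epsilon>, of x b y] by linarith
  qed
qed

text \<open>There are \<open>(T - t) / \<epsilon>\<^sup>2\<close> steps, so the errors of order \<open>\<epsilon>\<^sup>3\<close> sum to \<open>O((T - t) \<epsilon>)\<close>; the
  correction and the last step contribute \<open>O(\<epsilon>\<^sup>2)\<close>.\<close>

lemma value_fun_le:
  assumes \<epsilon>: "0 < \<epsilon>" "\<epsilon> \<le> 1" "\<epsilon> * \<Delta> \<le> 2 * (1 - \<kappa>)" and m: "m \<in> states d"
    and t: "t < T" "(T - t) / \<epsilon>\<^sup>2 \<in> \<int>"
  shows "value_fun q r \<phi> T \<epsilon> t m x y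
    \<le> u t x y + (H / A * K + last_step_const + step_const) * ((T - t) + \<epsilon>) * \<epsilon>"
proof -
  obtain k where k: "(T - t) / \<epsilon>\<^sup>2 = of_int k"
    using t(2) by (auto elim: Ints_cases)
  have "(T - t) / \<epsilon>\<^sup>2 > 0"
    using \<epsilon> t by simp
  then have "k > 0"
    by (simp add: k)
  then obtain n where n: "k = int (Suc n)"
    by (metis gr0_implies_Suc zero_less_imp_eq_int)
  have steps: "nat \<lfloor>(T - t) / \<epsilon>\<^sup>2\<rfloor> = Suc n"
    by (simp only: k n floor_of_int nat_int)
  have len: "T - t = real (Suc n) * \<epsilon>\<^sup>2"
    using k \<epsilon> by (simp add: n field_simps)
  have const_nonneg: "0 \<le> step_const" "0 \<le> last_step_const" "0 \<le> H / A * K"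
    using nonneg A \<Delta>_nonneg by (auto simp: step_const_def last_step_const_def)
  have "real n * (step_const * \<epsilon> ^ 3) = step_const * (real n * \<epsilon>\<^sup>2) * \<epsilon>"
    by (simp add: power2_eq_square power3_eq_cube)
  also have "\<dots> \<le> step_const * (T - t) * \<epsilon>"
    unfolding len using const_nonneg \<epsilon> by (intro mult_right_mono mult_left_mono) auto
  finally have main: "real n * (step_const * \<epsilon> ^ 3) \<le> step_const * (T - t) * \<epsilon>" .
  have "value_fun q r \<phi> T \<epsilon> t m x y
      \<le> u t x y - \<epsilon>\<^sup>2 * h m * D_t u t x y / A + last_step_const * \<epsilon>\<^sup>2 + real n * (step_const * \<epsilon> ^ 3)"
    unfolding value_fun_def steps using len by (intro value_steps_le[OF \<epsilon> m]) simp
  also have "\<dots> \<le> u t x y + \<epsilon>\<^sup>2 * (H / A * K) + last_step_const * \<epsilon>\<^sup>2 + step_const * (T - t) * \<epsilon>"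
    using main abs_le_D2[OF abs_correction_le[OF t(1) m, of \<epsilon> x y]] by linarith
  also have "\<dots> \<le> u t x y + \<epsilon>\<^sup>2 * (H / A * K) + last_step_const * \<epsilon>\<^sup>2 + step_const * (T - t) * \<epsilon>
      + ((H / A * K + last_step_const) * ((T - t) * \<epsilon>) + step_const * \<epsilon>\<^sup>2)"
    using const_nonneg t \<epsilon> by simp
  also have "\<dots> = u t x y + (H / A * K + last_step_const + step_const) * ((T - t) + \<epsilon>) * \<epsilon>"
    by (simp add: algebra_simps power2_eq_square add_divide_distrib diff_divide_distrib)
  finally show ?thesis .
qed

end

section \<open>The upper bound\<close>

theorem theorem5p2:
  fixes d :: nat and q r :: "bool list \<Rightarrow> real" and \<phi> :: "real \<Rightarrow> real \<Rightarrow> real" and K c :: real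
  assumes "d \<ge> 1"
    and "\<forall>m\<in>states d. \<bar>q m\<bar> < 1" and "\<forall>m\<in>states d. \<bar>r m\<bar> < 1"
    and "\<exists>m\<in>states d. q m \<noteq> r m"
    and "c > 0"
  shows "\<exists>C \<epsilon>\<^sub>0. \<epsilon>\<^sub>0 > 0 \<and>
    (\<forall>T u.
       solves_final_value_problem (lp_value d q r) T \<phi> u \<longrightarrow>
       regular_solution K T u \<longrightarrow>
       (\<forall>t \<xi> \<eta>. t < T \<longrightarrow> D_eta u t \<xi> \<eta> > c) \<longrightarrow>
       (\<forall>t \<xi> \<eta>. t < T \<longrightarrow> \<bar>D_xi u t \<xi> \<eta>\<bar> \<le> D_eta u t \<xi> \<eta>) \<longrightarrow>
       (\<forall>t \<xi> \<eta>. t < T \<longrightarrow> D_t u t \<xi> \<eta> \<le> 0) \<longrightarrow>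
       (\<forall>\<epsilon> t \<xi> \<eta>. \<forall>m\<in>states d.
          0 < \<epsilon> \<longrightarrow> \<epsilon> < \<epsilon>\<^sub>0 \<longrightarrow> t < T \<longrightarrow> (T - t) / \<epsilon>\<^sup>2 \<in> \<int> \<longrightarrow>
          value_fun q r \<phi> T \<epsilon> t m \<xi> \<eta> \<le> u t \<xi> \<eta> + C * ((T - t) + \<epsilon>) * \<epsilon>))"
proof -
  \<comment> \<open>The discrete Poisson equation is solved with the mean in place of the optimal value; since the
    mean is the smaller of the two, its solution satisfies the inequality needed for the latter.\<close>
  define A where "A = lp_value d q r"
  obtain h \<beta> where pot: "\<And>m b. m \<in> states d \<Longrightarrow>
      h (next_state m b) + (q m - r m)\<^sup>2 - outcome b * \<beta> m - mean_sq d q r = h m"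
    using potential_exists[OF assms(1)] by blast
  have mean_le: "mean_sq d q r \<le> A"
    unfolding A_def by (rule mean_sq_le_lp_value[OF assms(1)])
  obtain m\<^sub>0 where m\<^sub>0: "m\<^sub>0 \<in> states d" "q m\<^sub>0 \<noteq> r m\<^sub>0"
    using assms(4) by blast
  have "(\<Sum>m\<in>states d. (q m - r m)\<^sup>2) > 0"
    by (rule sum_pos2[OF finite_states m\<^sub>0(1)]) (use m\<^sub>0 in auto)
  then have "mean_sq d q r > 0"
    by (simp add: mean_sq_def)
  then have A: "A > 0"
    using mean_le by linarith
  have bound: "\<bar>g m\<bar> \<le> Max ((\<lambda>m. \<bar>g m\<bar>) ` states d)" if "m \<in> states d" for g :: "bool list \<Rightarrow> real" and m
    using that finite_states by simp
  define H where "H = Max ((\<lambda>m. \<bar>h m\<bar>) ` states d)"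
  define B where "B = Max ((\<lambda>m. \<bar>\<beta> m\<bar>) ` states d)"
  define \<kappa> where "\<kappa> = Max ((\<lambda>m. max \<bar>q m\<bar> \<bar>r m\<bar>) ` states d)"
  have \<kappa>: "\<kappa> < 1"
    unfolding \<kappa>_def using assms(2,3) finite_states m\<^sub>0 by (subst Max_less_iff) auto
  have experts: "\<bar>q m\<bar> \<le> \<kappa> \<and> \<bar>r m\<bar> \<le> \<kappa>" if "m \<in> states d" for m
  proof -
    have "max \<bar>q m\<bar> \<bar>r m\<bar> \<le> \<kappa>"
      unfolding \<kappa>_def using that finite_states by (intro Max_ge) auto
    then show ?thesis by simp
  qed
  define D where "D = B * K / (A * c)"
  define C where "C = H / A * K + ((B + 4 + H) / A + 36 + 5 * D) * K + (43 + 5 * D + 7 * H / A) * K"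
  \<comment> \<open>The absolute value keeps the threshold positive when \<open>K < 0\<close>, where no \<open>u\<close> is regular.\<close>
  define \<epsilon>\<^sub>0 where "\<epsilon>\<^sub>0 = min 1 (2 * (1 - \<kappa>) / (\<bar>D\<bar> + 1))"
  have "\<epsilon>\<^sub>0 > 0"
    using \<kappa> by (simp add: \<epsilon>\<^sub>0_def add_nonneg_pos)
  moreover have "value_fun q r \<phi> T \<epsilon> t m \<xi> \<eta> \<le> u t \<xi> \<eta> + C * ((T - t) + \<epsilon>) * \<epsilon>"
    if "solves_final_value_problem (lp_value d q r) T \<phi> u" "regular_solution K T u"
      "\<forall>t \<xi> \<eta>. t < T \<longrightarrow> D_eta u t \<xi> \<eta> > c"
      "\<forall>t \<xi> \<eta>. t < T \<longrightarrow> \<bar>D_xi u t \<xi> \<eta>\<bar> \<le> D_eta u t \<xi> \<eta>"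
      "\<forall>t \<xi> \<eta>. t < T \<longrightarrow> D_t u t \<xi> \<eta> \<le> 0"
      and m: "m \<in> states d" and \<epsilon>: "0 < \<epsilon>" "\<epsilon> < \<epsilon>\<^sub>0" and t: "t < T" "(T - t) / \<epsilon>\<^sup>2 \<in> \<int>"
    for T u \<epsilon> t \<xi> \<eta> m
  proof -
    have "h (next_state m b) + (q m - r m)\<^sup>2 - outcome b * \<beta> m - A \<le> h m" if "m \<in> states d" for m b
      using pot[OF that, of b] mean_le by linarith
    then interpret controlled_solution d q r h \<beta> A B H \<kappa> K c T \<phi> u
      using that(1-5) assms(1,5) A \<kappa> experts bound
      by unfold_locales (auto simp: A_def[symmetric] H_def B_def next_state_in_states)
    have "\<epsilon> * D \<le> \<epsilon> * (\<bar>D\<bar> + 1)"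
      using \<epsilon> by (intro mult_left_mono) auto
    also have "\<dots> \<le> 2 * (1 - \<kappa>)"
      using \<epsilon> by (simp add: \<epsilon>\<^sub>0_def field_simps add_nonneg_pos)
    finally have "\<epsilon> * D \<le> 2 * (1 - \<kappa>)" .
    moreover have "\<epsilon> \<le> 1"
      using \<epsilon> by (simp add: \<epsilon>\<^sub>0_def)
    ultimately show ?thesis
      using value_fun_le[OF \<epsilon>(1) _ _ m t, of \<xi> \<eta>]
      unfolding C_def D_def last_step_const_def step_const_def \<Delta>_def
      by blast
  qed
  ultimately show ?thesis
    by blast
qed

end
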